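(* Let $T$ be an ordered tree bigraph. For all reals $c,\tau>0$ there exists $\delta>0$ with the following property. Let $n\ge1$ be an integer, and let $G$ be an ordered bigraph not containing $T$, with $|V_1(G)|,|V_2(G)|\ge n$, and with at most $(1-\tau)|V_1(G)|\cdot|V_2(G)|$ edges. Then there are subsets $Z_i\subseteq V_i(G)$ for $i=1,2$, either with $|Z_1|\ge\delta n$ and $|Z_2|\ge \delta n^{1-c}$, or with $|Z_1|\ge\delta n^{1-c}$ and $|Z_2|\ge\delta n$, such that $Z_1,Z_2$ are anticomplete.
   Context: All graphs are finite, with no loops or parallel edges. A bigraph is a graph $G$ together with a bipartition $(V_1(G),V_2(G))$ of its vertex set (the two parts are disjoint with union $V(G)$, and every edge joins a vertex of $V_1(G)$ to a vertex of $V_2(G)$). An ordered bigraph is a bigraph with a linear order on $V_1(G)$ and a linear order on $V_2(G)$. An ordered bigraph $G$ contains an ordered bigraph $H$ if there is an induced subgraph $H'$ of $G$ and a graph isomorphism from $H$ to $H'$ mapping $V_i(H)$ into $V_i(G)$ for $i=1,2$ and carrying the order of $V_i(H)$ to the order inherited from $V_i(G)$, for $i=1,2$. An ordered tree bigraph is an ordered bigraph whose underlying graph is a tree. Two disjoint sets of vertices are anticomplete if there are no edges between them. *)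

theory Defs
  imports Complex_Main
begin

text \<open>
  Graphs are undirected: an edge is a two-element set of vertices, which rules out loops and
  parallel edges.  The AFP entry \<open>Graph_Theory\<close> is not used, since in its notion of forest a
  symmetric pair of arcs already counts as a cycle.
\<close>

record 'a graph =
  verts :: "'a set"
  edges :: "'a set set"

definition finite_graph :: "('a, 'x) graph_scheme \<Rightarrow> bool" where
  "finite_graph G \<longleftrightarrow> finite (verts G) \<and> (\<forall>e\<in>edges G. e \<subseteq> verts G \<and> card e = 2)"

definition connected_graph :: "('a, 'x) graph_scheme \<Rightarrow> bool" where
  "connected_graph G \<longleftrightarrow> verts G \<noteq> {} \<and>
     (\<forall>u\<in>verts G. \<forall>v\<in>verts G. (u, v) \<in> {(x, y). {x, y} \<in> edges G}\<^sup>*)"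

definition is_cycle :: "('a, 'x) graph_scheme \<Rightarrow> 'a list \<Rightarrow> bool" where
  "is_cycle G xs \<longleftrightarrow> 3 \<le> length xs \<and> distinct xs \<and>
     (\<forall>i<length xs. {xs ! i, xs ! (Suc i mod length xs)} \<in> edges G)"

definition is_tree :: "('a, 'x) graph_scheme \<Rightarrow> bool" where
  "is_tree G \<longleftrightarrow> finite_graph G \<and> connected_graph G \<and> (\<nexists>xs. is_cycle G xs)"

definition is_induced_subgraph :: "('a, 'x) graph_scheme \<Rightarrow> ('a, 'y) graph_scheme \<Rightarrow> bool" where
  "is_induced_subgraph H G \<longleftrightarrow>
     verts H \<subseteq> verts G \<and> edges H = {e \<in> edges G. e \<subseteq> verts H}"

definition is_graph_iso ::
  "('a \<Rightarrow> 'b) \<Rightarrow> ('a, 'x) graph_scheme \<Rightarrow> ('b, 'y) graph_scheme \<Rightarrow> bool" where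
  "is_graph_iso f H G \<longleftrightarrow> bij_betw f (verts H) (verts G) \<and>
     (\<forall>u\<in>verts H. \<forall>v\<in>verts H. {u, v} \<in> edges H \<longleftrightarrow> {f u, f v} \<in> edges G)"

definition anticomplete :: "('a, 'x) graph_scheme \<Rightarrow> 'a set \<Rightarrow> 'a set \<Rightarrow> bool" where
  "anticomplete G A B \<longleftrightarrow> A \<inter> B = {} \<and> (\<forall>a\<in>A. \<forall>b\<in>B. {a, b} \<notin> edges G)"

text \<open>The orders are reflexive relations: \<open>(u, v) \<in> ord1 G\<close> means $u \le v$ in the first part.\<close>

record 'a obigraph = "'a graph" +
  part1 :: "'a set"
  part2 :: "'a set"
  ord1 :: "'a rel"
  ord2 :: "'a rel"

definition is_ordered_bigraph :: "'a obigraph \<Rightarrow> bool" where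
  "is_ordered_bigraph G \<longleftrightarrow> finite_graph G \<and>
     part1 G \<inter> part2 G = {} \<and> part1 G \<union> part2 G = verts G \<and>
     (\<forall>e\<in>edges G. \<exists>u\<in>part1 G. \<exists>v\<in>part2 G. e = {u, v}) \<and>
     linear_order_on (part1 G) (ord1 G) \<and> linear_order_on (part2 G) (ord2 G)"

definition is_ordered_tree_bigraph :: "'a obigraph \<Rightarrow> bool" where
  "is_ordered_tree_bigraph T \<longleftrightarrow> is_ordered_bigraph T \<and> is_tree T"

definition contains_obigraph :: "'b obigraph \<Rightarrow> 'a obigraph \<Rightarrow> bool" where
  "contains_obigraph G H \<longleftrightarrow> (\<exists>(H' :: 'b graph) f.
     is_induced_subgraph H' G \<and> is_graph_iso f H H' \<and>
     f ` part1 H \<subseteq> part1 G \<and> f ` part2 H \<subseteq> part2 G \<and>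
     (\<forall>u\<in>part1 H. \<forall>v\<in>part1 H. (u, v) \<in> ord1 H \<longleftrightarrow> (f u, f v) \<in> ord1 G) \<and>
     (\<forall>u\<in>part2 H. \<forall>v\<in>part2 H. (u, v) \<in> ord2 H \<longleftrightarrow> (f u, f v) \<in> ord2 G))"

end

theory Submission
  imports Defs
begin

text \<open>
  Vertices of the first part are called rows and vertices of the second part columns.  The proof
  produces a linear set of rows and a set of about $n^{1-c}$ columns.

  A standard density decrement (\<open>sparse_subpair\<close>) reduces to a pair \<open>(A, B)\<close> of linear sets in which
  every column sees at most a small constant proportion of \<open>A\<close>: as long as the density is neither
  tiny nor close to one, either some large subpair has noticeably smaller density, or the pair is
  regular from below, hence also from above, and then every ordered bigraph embeds greedily.

  In the sparse range, where every column sees at most a proportion \<open>d\<close> of \<open>A\<close>, the decrement is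
  asymmetric.  Fix a small negative power \<open>\<nu>\<close> of \<open>n\<close>, a large integer
  \<open>C\<close>, and scales $\beta_k = \nu^{\Lambda^k}$.  If for some \<open>k\<close> there is a set of columns of
  proportion $\beta_k$ that a constant proportion of the rows sees with density below
  $\beta_k^C d$, then passing to these rows and to half of these columns costs a constant factor
  of rows, about a factor $\beta_k$ of columns, and lowers \<open>d\<close> by about $\beta_k^C$.  As every such
  step gains a fixed power of \<open>n\<close>, after a bounded number of steps \<open>d\<close> drops below \<open>1 / n\<close>.  Then no
  edge is left, the rows are still linear, and since \<open>C\<close> is large only a factor $n^{-c}$ of
  the columns is lost (\<open>sparse_anticomplete\<close>).

  It remains to see that a step is always possible (\<open>density_drop\<close>), that is, that the tree embeds
  if no step exists.  Reserve an interval of rows or columns for each tree vertex, ordered as the tree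
  prescribes.  The stronger claim proved by induction on the tree (\<open>abundant_copies\<close>) is that
  a copy exists inside arbitrary subsets of these intervals, of constant proportion for rows and of
  proportion $\beta_k$ for columns.  The tree is dismantled by removing pendant stars: a row vertex
  \<open>v\<close> together with its neighbours other than one column vertex \<open>w\<close>, all of them leaves by then.
  Because no step exists, almost all candidates for \<open>v\<close> see the (possibly tiny) candidate sets of
  all its neighbours with density at least $\beta_k^C d$.  So sets of about \<open>1 / d\<close> candidates for
  each leaf hit a polynomial proportion of the candidates for \<open>v\<close>, and about \<open>1 / d\<close> of the rows hit
  reach a polynomial proportion of the candidates for \<open>w\<close>.  Sets of size about \<open>1 / d\<close> reach only a
  small part of every other candidate set, which can be deleted to make the copy induced.  Only column
  sets become polynomially small for the later stages; the row set of \<open>v\<close> also does, but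
  \<open>v\<close> leaves the tree in the same stage.  This is why a decrement that keeps the rows linear suffices.
\<close>

section \<open>Counting edges between rows and columns\<close>

definition edge_count :: "('a \<Rightarrow> 'b \<Rightarrow> bool) \<Rightarrow> 'a set \<Rightarrow> 'b set \<Rightarrow> nat" where
  "edge_count R A B = (\<Sum>a\<in>A. card {b\<in>B. R a b})"

lemma edge_count_swap:
  assumes "finite A" "finite B"
  shows "edge_count R A B = (\<Sum>b\<in>B. card {a\<in>A. R a b})"
proof -
  have "edge_count R A B = (\<Sum>a\<in>A. \<Sum>b\<in>{b\<in>B. R a b}. 1)"
    by (simp add: edge_count_def)
  also have "\<dots> = (\<Sum>b\<in>B. \<Sum>a\<in>{a\<in>A. R a b}. 1)"
    using assms by (rule sum.swap_restrict)
  finally show ?thesis by simp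
qed

lemma card_filter_split:
  assumes "finite W" "Y \<subseteq> W"
  shows "card {b\<in>W. P b} = card {b\<in>Y. P b} + card {b\<in>W - Y. P b}"
proof -
  have "{b\<in>W. P b} = {b\<in>Y. P b} \<union> {b\<in>W - Y. P b}" using assms(2) by auto
  then show ?thesis
    using card_Un_disjoint[of "{b\<in>Y. P b}" "{b\<in>W - Y. P b}"] assms finite_subset[OF assms(2,1)] by auto
qed

text \<open>
  Sets \<open>Q\<close> are built one vertex at a time; \<open>h\<close> is the coverage up to which a further gain of \<open>g\<close> is
  guaranteed.
\<close>

lemma greedy_cover:
  assumes fin: "finite X" "finite Z"
    and gain: "\<And>Y. Y \<subseteq> Z \<Longrightarrow> real (card Y) < h \<Longrightarrow> \<exists>q\<in>X. g \<le> real (card {z\<in>Z - Y. R q z})"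
  shows "\<exists>Q\<subseteq>X. card Q \<le> m \<and> min h (real m * g) \<le> real (card {z\<in>Z. \<exists>q\<in>Q. R q z})"
proof (induction m)
  case 0
  show ?case by (rule exI[of _ "{}"]) auto
next
  case (Suc m)
  then obtain Q where Q: "Q \<subseteq> X" "card Q \<le> m"
      "min h (real m * g) \<le> real (card {z\<in>Z. \<exists>q\<in>Q. R q z})" by auto
  let ?Y = "{z\<in>Z. \<exists>q\<in>Q. R q z}"
  show ?case
  proof (cases "real (card ?Y) < h")
    case False
    then have "min h (real (Suc m) * g) \<le> real (card ?Y)" by linarith
    moreover have "card Q \<le> Suc m" using Q(2) by linarith
    ultimately show ?thesis using Q(1) by blast
  next
    case True
    then obtain q where q: "q \<in> X" "g \<le> real (card {z\<in>Z - ?Y. R q z})"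
      using gain[of ?Y] by auto
    let ?Q = "insert q Q"
    have finQ: "finite Q" using Q(1) fin(1) finite_subset by blast
    have eq: "{z\<in>Z. \<exists>q\<in>?Q. R q z} = ?Y \<union> {z\<in>Z - ?Y. R q z}" by auto
    have "card {z\<in>Z. \<exists>q\<in>?Q. R q z} = card ?Y + card {z\<in>Z - ?Y. R q z}"
      unfolding eq by (rule card_Un_disjoint) (use fin in auto)
    moreover have "real m * g \<le> real (card ?Y)" using Q(3) True by auto
    ultimately have "real (Suc m) * g \<le> real (card {z\<in>Z. \<exists>q\<in>?Q. R q z})"
      using q(2) by (simp add: algebra_simps)
    moreover have "card ?Q \<le> Suc m" using Q(2) finQ by (simp add: card_insert_if)
    moreover have "?Q \<subseteq> X" using Q(1) q(1) by simp
    ultimately show ?thesis by (meson min.coboundedI2)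
  qed
qed

text \<open>
  Markov's inequality turns a bound on the density into a bound on the degrees of half of the columns.
\<close>

lemma half_columns_light:
  assumes "finite A" "finite B"
    and up: "real (edge_count R A B) \<le> e * real (card A) * real (card B)" and pos: "0 < e" "A \<noteq> {}"
  shows "real (card B) / 2 \<le> real (card {b\<in>B. real (card {a\<in>A. R a b}) \<le> 2 * e * real (card A)})"
proof -
  let ?L = "{b\<in>B. real (card {a\<in>A. R a b}) \<le> 2 * e * real (card A)}"
  let ?H = "B - ?L"
  have "real (card ?H) * (2 * e * real (card A)) = (\<Sum>b\<in>?H. 2 * e * real (card A))" by simp
  also have "\<dots> \<le> (\<Sum>b\<in>?H. real (card {a\<in>A. R a b}))" by (rule sum_mono) auto
  also have "\<dots> \<le> (\<Sum>b\<in>B. real (card {a\<in>A. R a b}))" using assms(2) by (intro sum_mono2) auto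
  also have "\<dots> = real (edge_count R A B)" by (simp add: edge_count_swap[OF assms(1,2)])
  finally have "real (card ?H) * (2 * e * real (card A)) \<le> e * real (card A) * real (card B)" using up by simp
  then have "(real (card ?H) * 2) * (e * real (card A)) \<le> real (card B) * (e * real (card A))"
    by (simp add: algebra_simps)
  moreover have "0 < e * real (card A)" using pos assms(1) by (simp add: card_gt_0_iff)
  ultimately have "real (card ?H) * 2 \<le> real (card B)" using mult_le_cancel_right_pos by blast
  moreover have "card ?H = card B - card ?L" using assms(2) by (intro card_Diff_subset) auto
  moreover have "card ?L \<le> card B" using assms(2) by (intro card_mono) auto
  ultimately show ?thesis by linarith
qed

lemma card_union_cols:
  assumes "finite Q" "finite A" and "\<And>q. q \<in> Q \<Longrightarrow> real (card {a\<in>A. R q a}) \<le> c"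
  shows "real (card {a\<in>A. \<exists>q\<in>Q. R q a}) \<le> real (card Q) * c"
proof -
  have "{a\<in>A. \<exists>q\<in>Q. R q a} = (\<Union>q\<in>Q. {a\<in>A. R q a})" by auto
  then have "card {a\<in>A. \<exists>q\<in>Q. R q a} \<le> (\<Sum>q\<in>Q. card {a\<in>A. R q a})"
    using card_UN_le[OF assms(1), of "\<lambda>q. {a\<in>A. R q a}"] by simp
  then have "real (card {a\<in>A. \<exists>q\<in>Q. R q a}) \<le> real (\<Sum>q\<in>Q. card {a\<in>A. R q a})"
    by (rule of_nat_mono)
  also have "\<dots> = (\<Sum>q\<in>Q. real (card {a\<in>A. R q a}))" by (rule of_nat_sum)
  also have "\<dots> \<le> (\<Sum>q\<in>Q. c)" by (rule sum_mono) (rule assms(3))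
  finally show ?thesis by simp
qed

section \<open>Greedy hitting and covering\<close>

lemma exists_large_row:
  assumes "finite A" "A \<noteq> {}" "c * real (card A) \<le> real (edge_count R A B)"
  shows "\<exists>a\<in>A. c \<le> real (card {b\<in>B. R a b})"
proof (rule ccontr)
  assume "\<not> ?thesis"
  then have "(\<Sum>a\<in>A. real (card {b\<in>B. R a b})) < (\<Sum>a\<in>A. c)"
    using assms by (intro sum_strict_mono) auto
  then show False using assms(3) by (simp add: edge_count_def mult.commute)
qed

lemma exists_large_column:
  assumes "finite A" "finite B" "B \<noteq> {}" "c * real (card B) \<le> real (edge_count R A B)"
  shows "\<exists>b\<in>B. c \<le> real (card {a\<in>A. R a b})"
proof -
  have "edge_count R A B = edge_count (\<lambda>b a. R a b) B A"
    unfolding edge_count_swap[OF assms(1,2)] by (simp add: edge_count_def)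
  then show ?thesis using exists_large_row[of B c "\<lambda>b a. R a b" A] assms by simp
qed

text \<open>
  While at least half of \<open>A\<close> is not hit, averaging gives a column that hits a proportion \<open>\<theta>\<close> of the
  rest, so roughly \<open>1 / \<theta>\<close> columns suffice for a constant proportion.
\<close>

lemma hit_rows:
  fixes \<theta> :: real
  assumes "finite A" "finite X" "X \<noteq> {}" "0 \<le> \<theta>"
    and deg: "\<And>a. a \<in> A \<Longrightarrow> \<theta> * real (card X) \<le> real (card {b\<in>X. R a b})"
  shows "\<exists>Q\<subseteq>X. card Q \<le> m \<and>
    min (1/2) (real m * \<theta> / 2) * real (card A) \<le> real (card {a\<in>A. \<exists>q\<in>Q. R a q})"
proof -
  have "\<exists>Q\<subseteq>X. card Q \<le> m \<and> min (real (card A) / 2) (real m * (\<theta> * real (card A) / 2))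
      \<le> real (card {a\<in>A. \<exists>q\<in>Q. R a q})"
  proof (rule greedy_cover[where R = "\<lambda>q a. R a q"])
    fix Y assume Y: "Y \<subseteq> A" "real (card Y) < real (card A) / 2"
    have "card (A - Y) = card A - card Y" "card Y \<le> card A"
      using Y(1) assms(1) by (auto intro: card_Diff_subset card_mono finite_subset)
    then have half: "real (card A) / 2 \<le> real (card (A - Y))" using Y(2) by linarith
    have "(\<theta> * real (card A) / 2) * real (card X) = real (card A) / 2 * (\<theta> * real (card X))" by simp
    also have "\<dots> \<le> real (card (A - Y)) * (\<theta> * real (card X))"
      using half assms(4) by (intro mult_right_mono) auto
    also have "\<dots> = (\<Sum>a\<in>A - Y. \<theta> * real (card X))" by simp
    also have "\<dots> \<le> (\<Sum>a\<in>A - Y. real (card {b\<in>X. R a b}))"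
      using deg by (intro sum_mono) auto
    finally have "(\<theta> * real (card A) / 2) * real (card X) \<le> real (edge_count R (A - Y) X)"
      by (simp add: edge_count_def)
    then show "\<exists>q\<in>X. \<theta> * real (card A) / 2 \<le> real (card {z\<in>A - Y. R z q})"
      using exists_large_column[of "A - Y" X] assms by blast
  qed (use assms in auto)
  moreover have "min (real (card A) / 2) (real m * (\<theta> * real (card A) / 2))
      = min (1/2) (real m * \<theta> / 2) * real (card A)"
    unfolding min_mult_distrib_right by (simp add: mult_ac)
  ultimately show ?thesis by simp
qed

text \<open>
  Hitting is done for the leaves one after the other, each time within the rows that are already hit
  for the earlier ones; this gives rows that can serve all leaves simultaneously.
\<close>

lemma hit_rows_all:
  fixes \<theta> :: real
  assumes "finite U" "finite A" "0 \<le> \<theta>"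
    and "\<And>u. u \<in> U \<Longrightarrow> finite (X u) \<and> X u \<noteq> {}"
    and deg: "\<And>u a. u \<in> U \<Longrightarrow> a \<in> A \<Longrightarrow> \<theta> * real (card (X u)) \<le> real (card {b\<in>X u. R a b})"
  shows "\<exists>Q. (\<forall>u\<in>U. Q u \<subseteq> X u \<and> card (Q u) \<le> m) \<and>
    min (1/2) (real m * \<theta> / 2) ^ card U * real (card A)
      \<le> real (card {a\<in>A. \<forall>u\<in>U. \<exists>q\<in>Q u. R a q})"
  using assms(1,4,5)
proof (induction U rule: finite_induct)
  case empty
  then show ?case by simp
next
  case (insert u U)
  let ?h = "min (1/2) (real m * \<theta> / 2)"
  from insert obtain Q where Q: "\<forall>u\<in>U. Q u \<subseteq> X u \<and> card (Q u) \<le> m"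
    and QA: "?h ^ card U * real (card A) \<le> real (card {a\<in>A. \<forall>u\<in>U. \<exists>q\<in>Q u. R a q})"
    by auto
  let ?A = "{a\<in>A. \<forall>u\<in>U. \<exists>q\<in>Q u. R a q}"
  obtain Q' where Q': "Q' \<subseteq> X u" "card Q' \<le> m"
      "?h * real (card ?A) \<le> real (card {a\<in>?A. \<exists>q\<in>Q'. R a q})"
    using hit_rows[of ?A "X u" \<theta> R m] assms(2,3) insert.prems by auto
  have eq: "{a\<in>A. \<forall>x\<in>insert u U. \<exists>q\<in>(Q(u := Q')) x. R a q} = {a\<in>?A. \<exists>q\<in>Q'. R a q}"
    using insert.hyps(2) by auto
  have "?h ^ card (insert u U) * real (card A) = ?h * (?h ^ card U * real (card A))"
    using insert.hyps by simp
  also have "\<dots> \<le> ?h * real (card ?A)" using QA assms(3) by (intro mult_left_mono) auto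
  also note Q'(3)
  finally show ?case using Q Q'(1,2) insert.hyps(2)
    by (intro exI[of _ "Q(u := Q')"]) (unfold eq, auto)
qed

text \<open>
  The rows of \<open>Q\<close> may share their neighbours, and \<open>Q\<close> may be a tiny part of \<open>A\<close>.  But a set \<open>Y\<close> of
  columns absorbs at most \<open>card Y * d * card A\<close> edges, so a set \<open>Y\<close> smaller than a proportion
  \<open>\<gamma> * \<rho> / 2\<close> of \<open>W\<close> absorbs at most half of the edges leaving \<open>Q\<close>, and some row still gains.
\<close>

lemma cover_columns:
  fixes d \<gamma> \<rho> :: real
  assumes "finite A" "finite W" and QA: "Q \<subseteq> A" "Q \<noteq> {}" "\<rho> * real (card A) \<le> real (card Q)"
    and pos: "0 < d" "0 < \<gamma>"
    and col: "\<And>b. b \<in> W \<Longrightarrow> real (card {a\<in>A. R a b}) \<le> d * real (card A)"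
    and row: "\<And>a. a \<in> Q \<Longrightarrow> \<gamma> * d * real (card W) \<le> real (card {b\<in>W. R a b})"
  shows "\<exists>P\<subseteq>Q. card P \<le> m \<and>
    min (\<gamma> * \<rho> / 2) (real m * (\<gamma> * d) / 2) * real (card W) \<le> real (card {b\<in>W. \<exists>a\<in>P. R a b})"
proof -
  have finQ: "finite Q" using QA assms(1) finite_subset by blast
  have "\<exists>P\<subseteq>Q. card P \<le> m \<and>
    min (\<gamma> * \<rho> / 2 * real (card W)) (real m * (\<gamma> * d * real (card W) / 2)) \<le> real (card {b\<in>W. \<exists>a\<in>P. R a b})"
  proof (rule greedy_cover)
    fix Y assume Y: "Y \<subseteq> W" "real (card Y) < \<gamma> * \<rho> / 2 * real (card W)"
    have finY: "finite Y" using Y(1) assms(2) finite_subset by blast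
    have split: "card {b\<in>W. R a b} = card {b\<in>Y. R a b} + card {b\<in>W - Y. R a b}" for a
      using card_filter_split[OF assms(2) Y(1)] .
    have "real (edge_count R Q Y) = (\<Sum>b\<in>Y. real (card {a\<in>Q. R a b}))"
      using edge_count_swap[OF finQ finY, of R] by simp
    also have "\<dots> \<le> (\<Sum>b\<in>Y. d * real (card A))"
    proof (rule sum_mono)
      fix b assume "b \<in> Y"
      have "card {a\<in>Q. R a b} \<le> card {a\<in>A. R a b}"
        using QA(1) assms(1) by (intro card_mono) auto
      then show "real (card {a\<in>Q. R a b}) \<le> d * real (card A)"
        using col[of b] Y(1) \<open>b \<in> Y\<close> by (meson of_nat_le_iff order_trans subsetD)
    qed
    also have "\<dots> = real (card Y) * (d * real (card A))" by simp
    also have "\<dots> \<le> (\<gamma> * \<rho> / 2 * real (card W)) * (d * real (card A))"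
      using Y(2) pos by (intro mult_right_mono) auto
    also have "\<dots> = (\<gamma> * d / 2 * real (card W)) * (\<rho> * real (card A))" by simp
    also have "\<dots> \<le> (\<gamma> * d / 2 * real (card W)) * real (card Q)"
      using QA(3) pos by (intro mult_left_mono) auto
    finally have up: "real (edge_count R Q Y) \<le> \<gamma> * d / 2 * real (card W) * real (card Q)" .
    have "real (card Q) * (\<gamma> * d * real (card W)) = (\<Sum>a\<in>Q. \<gamma> * d * real (card W))" by simp
    also have "\<dots> \<le> (\<Sum>a\<in>Q. real (card {b\<in>W. R a b}))" using row by (intro sum_mono) auto
    also have "\<dots> = real (edge_count R Q Y) + real (edge_count R Q (W - Y))"
      by (simp add: edge_count_def split sum.distrib)
    finally have "(\<gamma> * d * real (card W) / 2) * real (card Q) \<le> real (edge_count R Q (W - Y))"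
      using up by (simp add: algebra_simps)
    then show "\<exists>q\<in>Q. \<gamma> * d * real (card W) / 2 \<le> real (card {z\<in>W - Y. R q z})"
      using exists_large_row[of Q] finQ QA(2) by blast
  qed (use finQ assms in auto)
  moreover have "min (\<gamma> * \<rho> / 2 * real (card W)) (real m * (\<gamma> * d * real (card W) / 2)) =
      min (\<gamma> * \<rho> / 2) (real m * (\<gamma> * d) / 2) * real (card W)"
    unfolding min_mult_distrib_right by (simp add: mult_ac)
  ultimately show ?thesis by simp
qed

section \<open>Removing a pendant star\<close>

definition is_copy ::
  "('v \<Rightarrow> 'w \<Rightarrow> bool) \<Rightarrow> ('t \<Rightarrow> 'u \<Rightarrow> bool) \<Rightarrow> 't set \<Rightarrow> 'u set \<Rightarrow> ('t \<Rightarrow> 'v set) \<Rightarrow> ('u \<Rightarrow> 'w set)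
    \<Rightarrow> ('t \<Rightarrow> 'v) \<Rightarrow> ('u \<Rightarrow> 'w) \<Rightarrow> bool" where
  "is_copy R F S1 S2 X1 X2 f1 f2 \<longleftrightarrow> (\<forall>i\<in>S1. f1 i \<in> X1 i) \<and> (\<forall>x\<in>S2. f2 x \<in> X2 x) \<and>
     (\<forall>i\<in>S1. \<forall>x\<in>S2. R (f1 i) (f2 x) \<longleftrightarrow> F i x)"

text \<open>
  The proportion of the candidates for \<open>w\<close> that survives the removal of a star; what matters is only
  that it is bounded below by a constant times a power of \<open>\<gamma>\<close>.
\<close>

definition star_gain :: "real \<Rightarrow> real \<Rightarrow> nat \<Rightarrow> real" where
  "star_gain \<sigma> \<gamma> t = \<gamma> / 2 * ((\<sigma> * \<gamma> / (16 * real t)) ^ t * \<sigma> / 4)"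

text \<open>
  The star with centre \<open>v\<close> and leaves \<open>U\<close> is attached to the rest of the tree at \<open>w\<close>.  The
  candidates for \<open>v\<close> are first restricted to a set \<open>V\<close>: averaging over columns discards the rows to
  which some column set is \<open>heavy\<close>, and \<open>row\<close> discards those to which the set of a leaf or of \<open>w\<close> is
  \<open>light\<close>.  Then \<open>Q u\<close> are the candidates kept for the leaf \<open>u\<close>, \<open>H\<close> the rows that can serve all leaves,
  and \<open>P\<close> the candidates kept for \<open>v\<close>.  The new sets avoid all neighbours of the \<open>Q u\<close> and of \<open>P\<close>,
  except that the new set for \<open>w\<close> consists of neighbours of \<open>P\<close>.  Hence any copy of the smaller tree in
  the new sets extends: the image of \<open>w\<close> determines a choice for \<open>v\<close> in \<open>P\<close>, and this in turn
  determines the leaves.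
\<close>

lemma star_step:
  fixes d s \<sigma> \<gamma> :: real and t :: nat
  assumes fin: "finite A" "finite B"
    and col: "\<And>b. b \<in> B \<Longrightarrow> real (card {a\<in>A. R a b}) \<le> d * real (card A)"
    and par: "0 < d" "0 < \<sigma>" "\<sigma> \<le> 1" "0 < \<gamma>" "\<gamma> \<le> 1" "d \<le> \<sigma> / (4 * real t)" "real t * s \<le> \<sigma> / 4"
    and S: "v \<notin> S1" "w \<in> S2" "finite S2" "finite U" "U \<inter> S2 = {}" "card S2 + card U \<le> t"
    and X1: "\<And>i. i \<in> insert v S1 \<Longrightarrow> X1 i \<subseteq> A \<and> \<sigma> * real (card A) \<le> real (card (X1 i))"
    and X2: "\<And>x. x \<in> S2 \<union> U \<Longrightarrow> X2 x \<subseteq> B \<and> X2 x \<noteq> {}"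
    and row: "\<And>x. x \<in> insert w U \<Longrightarrow>
      real (card {a\<in>A. real (card {b\<in>X2 x. R a b}) < \<gamma> * d * real (card (X2 x))}) < s * real (card A)"
    and F: "\<And>x. x \<in> S2 \<Longrightarrow> F v x \<longleftrightarrow> x = w" "\<And>x. x \<in> U \<Longrightarrow> F v x"
      "\<And>i x. i \<in> S1 \<Longrightarrow> x \<in> U \<Longrightarrow> \<not> F i x"
  shows "\<exists>Y1 Y2. (\<forall>i\<in>S1. Y1 i \<subseteq> X1 i \<and> real (card (X1 i)) / 2 \<le> real (card (Y1 i))) \<and>
    (\<forall>x\<in>S2. Y2 x \<subseteq> X2 x \<and> star_gain \<sigma> \<gamma> t * real (card (X2 x)) \<le> real (card (Y2 x))) \<and>
    (\<forall>f1 f2. is_copy R F S1 S2 Y1 Y2 f1 f2 \<longrightarrow>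
      (\<exists>g1 g2. is_copy R F (insert v S1) (S2 \<union> U) X1 X2 g1 g2))"
proof -
  have t1: "1 \<le> t" using S by (metis Suc_leI add_is_0 card_eq_0_iff empty_iff le_trans less_eq_nat.simps(1) not_less_eq_eq One_nat_def le_zero_eq)
  have sA: "0 < s * real (card A)" using row[of w] by (meson insertI1 le_less_trans of_nat_0_le_iff)
  then have A0: "0 < real (card A)" and s0: "0 < s" by (auto simp: zero_less_mult_iff)
  have finX2: "finite (X2 x)" if "x \<in> S2 \<union> U" for x using X2[OF that] fin(2) finite_subset by blast
  have finX1: "finite (X1 i)" if "i \<in> insert v S1" for i using X1[OF that] fin(1) finite_subset by blast
  define e where "e = 2 * real t / \<sigma> * d"
  have e0: "0 < e" unfolding e_def using par t1 by simp
  define N where "N a x = real (card {b\<in>X2 x. R a b})" for a x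
  define heavy where "heavy x = {a\<in>X1 v. e * real (card (X2 x)) < N a x}" for x
  define light where "light x = {a\<in>A. N a x < \<gamma> * d * real (card (X2 x))}" for x
  have heavy: "real (card (heavy x)) \<le> real (card (X1 v)) / (2 * real t)" if x: "x \<in> S2" for x
  proof -
    have c0: "0 < real (card (X2 x))" using X2[of x] finX2[of x] x by (simp add: card_gt_0_iff)
    have "real (card (heavy x)) * (e * real (card (X2 x))) = (\<Sum>a\<in>heavy x. e * real (card (X2 x)))" by simp
    also have "\<dots> \<le> (\<Sum>a\<in>heavy x. N a x)" by (rule sum_mono) (simp add: heavy_def)
    also have "\<dots> \<le> (\<Sum>a\<in>X1 v. N a x)"
      using finX1[of v] by (intro sum_mono2) (auto simp: heavy_def N_def)
    also have "\<dots> = (\<Sum>b\<in>X2 x. real (card {a\<in>X1 v. R a b}))"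
      using edge_count_swap[of "X1 v" "X2 x" R] finX1[of v] finX2[of x] x
      by (simp add: edge_count_def N_def flip: of_nat_sum)
    also have "\<dots> \<le> (\<Sum>b\<in>X2 x. d * real (card (X1 v)) / \<sigma>)"
    proof (rule sum_mono)
      fix b assume b: "b \<in> X2 x"
      have "card {a\<in>X1 v. R a b} \<le> card {a\<in>A. R a b}"
        using X1[of v] fin by (intro card_mono) auto
      then have "real (card {a\<in>X1 v. R a b}) \<le> d * real (card A)"
        using col[of b] X2[of x] x b by (meson UnI1 of_nat_le_iff order_trans subsetD)
      also have "\<dots> \<le> d * (real (card (X1 v)) / \<sigma>)"
        using X1[of v] par by (intro mult_left_mono) (auto simp: field_simps)
      finally show "real (card {a\<in>X1 v. R a b}) \<le> d * real (card (X1 v)) / \<sigma>" by simp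
    qed
    also have "\<dots> = (real (card (X1 v)) / (2 * real t)) * (e * real (card (X2 x)))"
      unfolding e_def using t1 by simp
    finally show ?thesis using c0 e0 by (meson mult_le_cancel_right_pos mult_pos_pos)
  qed
  define V where "V = X1 v - (\<Union>x\<in>S2. heavy x) - (\<Union>x\<in>insert w U. light x)"
  have finV: "finite V" unfolding V_def using finX1[of v] by simp
  have VA: "V \<subseteq> A" unfolding V_def using X1[of v] by auto
  have Vcard: "\<sigma> / 4 * real (card A) \<le> real (card V)"
  proof -
    have "real (card (\<Union>x\<in>S2. heavy x)) \<le> (\<Sum>x\<in>S2. real (card (heavy x)))"
      using card_UN_le[OF S(3), of heavy] by (simp flip: of_nat_sum)
    also have "\<dots> \<le> (\<Sum>x\<in>S2. real (card (X1 v)) / (2 * real t))" by (rule sum_mono) (rule heavy)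
    also have "\<dots> = real (card S2) * (real (card (X1 v)) / (2 * real t))" by simp
    also have "\<dots> \<le> real t * (real (card (X1 v)) / (2 * real t))"
      using S(6) by (intro mult_right_mono) auto
    also have "\<dots> = real (card (X1 v)) / 2" using t1 by simp
    finally have h: "real (card (\<Union>x\<in>S2. heavy x)) \<le> real (card (X1 v)) / 2" .
    have "0 < card S2" using S by (auto simp: card_gt_0_iff)
    then have cU: "card (insert w U) \<le> t" using S by (simp add: card_insert_if)
    have "real (card (\<Union>x\<in>insert w U. light x)) \<le> (\<Sum>x\<in>insert w U. real (card (light x)))"
      using card_UN_le[of "insert w U" light] S(4) by (metis finite_insert of_nat_le_iff of_nat_sum)
    also have "\<dots> \<le> (\<Sum>x\<in>insert w U. s * real (card A))"
      using row by (intro sum_mono) (fastforce simp: light_def N_def)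
    also have "\<dots> = real (card (insert w U)) * (s * real (card A))" by simp
    also have "\<dots> \<le> real t * (s * real (card A))"
      using cU sA by (intro mult_right_mono) auto
    also have "\<dots> \<le> \<sigma> / 4 * real (card A)" using par(7) A0
      by (metis mult.assoc mult_right_mono less_imp_le)
    finally have l: "real (card (\<Union>x\<in>insert w U. light x)) \<le> \<sigma> / 4 * real (card A)" .
    have "X1 v \<subseteq> V \<union> (\<Union>x\<in>S2. heavy x) \<union> (\<Union>x\<in>insert w U. light x)" unfolding V_def by auto
    then have "card (X1 v) \<le> card (V \<union> (\<Union>x\<in>S2. heavy x) \<union> (\<Union>x\<in>insert w U. light x))"
      using finV S fin finX1[of v] by (intro card_mono) (auto simp: heavy_def light_def)
    also have "\<dots> \<le> card V + card (\<Union>x\<in>S2. heavy x) + card (\<Union>x\<in>insert w U. light x)"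
      by (meson add_le_mono1 card_Un_le le_trans)
    finally have "real (card (X1 v)) \<le> real (card V) + real (card (\<Union>x\<in>S2. heavy x))
        + real (card (\<Union>x\<in>insert w U. light x))" by (simp flip: of_nat_add)
    then have "real (card (X1 v)) / 2 \<le> real (card V) + \<sigma> / 4 * real (card A)" using h l by linarith
    then show ?thesis using X1[of v] by simp
  qed
  \<comment> \<open>The neighbourhoods of \<open>m\<close> vertices of degree proportion about \<open>d\<close> cover at most a small
    constant proportion of each candidate set, but a proportion that does not depend on \<open>d\<close>.\<close>
  define m where "m = nat \<lfloor>\<sigma> / (4 * real t * d)\<rfloor>"
  have y1: "1 \<le> \<sigma> / (4 * real t * d)" using par t1 by (simp add: field_simps)
  have m_le: "real m * d \<le> \<sigma> / (4 * real t)"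
  proof -
    have "real m \<le> \<sigma> / (4 * real t * d)" unfolding m_def using y1 by simp
    then have "real m * d \<le> \<sigma> / (4 * real t * d) * d" using par(1) by (intro mult_right_mono) auto
    then show ?thesis using par(1) by simp
  qed
  have m_ge: "\<sigma> / (8 * real t) \<le> real m * d"
  proof -
    have "1 \<le> \<lfloor>\<sigma> / (4 * real t * d)\<rfloor>" using y1 by simp
    then have "1 \<le> real_of_int \<lfloor>\<sigma> / (4 * real t * d)\<rfloor>" by linarith
    moreover have "real m = real_of_int \<lfloor>\<sigma> / (4 * real t * d)\<rfloor>" unfolding m_def using y1 by simp
    ultimately have "\<sigma> / (4 * real t * d) \<le> 2 * real m"
      using real_of_int_floor_add_one_gt[of "\<sigma> / (4 * real t * d)"] by linarith
    then have "\<sigma> / (4 * real t * d) * d \<le> 2 * real m * d" using par(1) by (intro mult_right_mono) auto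
    then show ?thesis using par(1) by simp
  qed
  have V_light: "\<gamma> * d * real (card (X2 x)) \<le> N a x" if "a \<in> V" "x \<in> insert w U" for a x
    using that X1[of v] unfolding V_def light_def by force
  have "\<exists>Q. (\<forall>u\<in>U. Q u \<subseteq> X2 u \<and> card (Q u) \<le> m) \<and>
      min (1/2) (real m * (\<gamma> * d) / 2) ^ card U * real (card V)
        \<le> real (card {a\<in>V. \<forall>u\<in>U. \<exists>q\<in>Q u. R a q})"
    using V_light X2 finX2 par S(4) finV by (intro hit_rows_all) (auto simp: N_def)
  then obtain Q where Q: "\<And>u. u \<in> U \<Longrightarrow> Q u \<subseteq> X2 u \<and> card (Q u) \<le> m"
    and QV: "min (1/2) (real m * (\<gamma> * d) / 2) ^ card U * real (card V)
        \<le> real (card {a\<in>V. \<forall>u\<in>U. \<exists>q\<in>Q u. R a q})" by blast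
  define H where "H = {a\<in>V. \<forall>u\<in>U. \<exists>q\<in>Q u. R a q}"
  define h where "h = \<sigma> * \<gamma> / (16 * real t)"
  have h0: "0 < h" unfolding h_def using par t1 by simp
  have sg: "\<sigma> * \<gamma> \<le> 1" using par by (simp add: mult_le_one)
  have h1: "h \<le> 1 / 16"
  proof -
    have "\<sigma> * \<gamma> \<le> 1 * real t" using sg t1 by linarith
    then show ?thesis unfolding h_def using t1 by (simp add: field_simps)
  qed
  have mgd: "h \<le> real m * (\<gamma> * d) / 2"
  proof -
    have "\<sigma> / (8 * real t) * \<gamma> \<le> real m * d * \<gamma>" using m_ge par by (intro mult_right_mono) auto
    then show ?thesis unfolding h_def by (simp add: mult_ac)
  qed
  define \<rho> where "\<rho> = h ^ t * \<sigma> / 4"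
  have H_card: "\<rho> * real (card A) \<le> real (card H)"
  proof -
    have "h ^ t \<le> h ^ card U" using h0 h1 S(6) by (intro power_decreasing) auto
    also have "\<dots> \<le> min (1/2) (real m * (\<gamma> * d) / 2) ^ card U"
      using h0 h1 mgd by (intro power_mono) auto
    finally have "h ^ t * (\<sigma> / 4 * real (card A)) \<le> min (1/2) (real m * (\<gamma> * d) / 2) ^ card U * real (card V)"
      using Vcard h0 par A0 by (intro mult_mono) auto
    then show ?thesis using QV unfolding \<rho>_def H_def by simp
  qed
  have \<rho>0: "0 < \<rho>" unfolding \<rho>_def using h0 par by simp
  have \<rho>h: "\<rho> \<le> h"
  proof -
    have "h ^ t \<le> h ^ 1" using h0 h1 t1 by (intro power_decreasing) auto
    moreover have "h ^ t * (\<sigma> / 4) \<le> h ^ t * 1" using h0 par by (intro mult_left_mono) auto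
    ultimately show ?thesis unfolding \<rho>_def by simp
  qed
  have HA: "H \<subseteq> A" using VA H_def by auto
  have "0 < real (card H)" using H_card \<rho>0 A0 by (meson less_le_trans mult_pos_pos)
  then have H_ne: "H \<noteq> {}" by auto
  have wS: "w \<in> S2 \<union> U" using S by auto
  have "\<exists>P\<subseteq>H. card P \<le> m \<and> min (\<gamma> * \<rho> / 2) (real m * (\<gamma> * d) / 2) * real (card (X2 w))
      \<le> real (card {b\<in>X2 w. \<exists>a\<in>P. R a b})"
  proof (rule cover_columns[OF fin(1) finX2[OF wS] HA H_ne H_card par(1,4)])
    show "real (card {a \<in> A. R a b}) \<le> d * real (card A)" if "b \<in> X2 w" for b
      using col X2[OF wS] that by auto
    show "\<gamma> * d * real (card (X2 w)) \<le> real (card {b \<in> X2 w. R a b})" if "a \<in> H" for a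
      using V_light[of a w] that by (auto simp: H_def N_def)
  qed
  then obtain P where P: "P \<subseteq> H" "card P \<le> m"
    and Pw: "min (\<gamma> * \<rho> / 2) (real m * (\<gamma> * d) / 2) * real (card (X2 w))
      \<le> real (card {b\<in>X2 w. \<exists>a\<in>P. R a b})" by blast
  have finP: "finite P" using P(1) HA fin(1) by (meson finite_subset)
  define Y1 where "Y1 i = X1 i - {a\<in>A. \<exists>u\<in>U. \<exists>q\<in>Q u. R a q}" for i
  define Y2 where "Y2 x = (if x = w then {b\<in>X2 w. \<exists>a\<in>P. R a b} else X2 x - {b\<in>X2 x. \<exists>a\<in>P. R a b})" for x
  have gain: "star_gain \<sigma> \<gamma> t = \<gamma> * \<rho> / 2" unfolding star_gain_def \<rho>_def h_def by simp
  have gain_half: "\<gamma> * \<rho> / 2 \<le> 1 / 2"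
  proof -
    have "\<gamma> * \<rho> \<le> 1" using \<rho>0 \<rho>h h1 par by (intro mult_le_one) auto
    then show ?thesis by simp
  qed
  have Y1: "Y1 i \<subseteq> X1 i \<and> real (card (X1 i)) / 2 \<le> real (card (Y1 i))" if i: "i \<in> S1" for i
  proof -
    have finQ: "finite (Q u)" if "u \<in> U" for u using Q[OF that] finX2[of u] that finite_subset by blast
    have one: "real (card {a\<in>A. \<exists>q\<in>Q u. R a q}) \<le> \<sigma> / (4 * real t) * real (card A)" if u: "u \<in> U" for u
    proof -
      have "real (card {a\<in>A. \<exists>q\<in>Q u. R a q}) \<le> real (card (Q u)) * (d * real (card A))"
        using col Q[OF u] X2[of u] u finQ[OF u] fin(1) by (intro card_union_cols) auto
      also have "\<dots> \<le> real m * (d * real (card A))"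
        using Q[OF u] par by (intro mult_right_mono) auto
      also have "\<dots> \<le> \<sigma> / (4 * real t) * real (card A)"
        using m_le by (metis mult.assoc mult_right_mono of_nat_0_le_iff)
      finally show ?thesis .
    qed
    let ?D = "{a\<in>A. \<exists>u\<in>U. \<exists>q\<in>Q u. R a q}"
    have "?D = (\<Union>u\<in>U. {a\<in>A. \<exists>q\<in>Q u. R a q})" by auto
    then have "card ?D \<le> (\<Sum>u\<in>U. card {a\<in>A. \<exists>q\<in>Q u. R a q})"
      using card_UN_le[OF S(4), of "\<lambda>u. {a\<in>A. \<exists>q\<in>Q u. R a q}"] by simp
    then have "real (card ?D) \<le> real (\<Sum>u\<in>U. card {a\<in>A. \<exists>q\<in>Q u. R a q})" by (rule of_nat_mono)
    also have "\<dots> = (\<Sum>u\<in>U. real (card {a\<in>A. \<exists>q\<in>Q u. R a q}))" by (rule of_nat_sum)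
    also have "\<dots> \<le> (\<Sum>u\<in>U. \<sigma> / (4 * real t) * real (card A))" by (rule sum_mono) (rule one)
    also have "\<dots> = real (card U) * (\<sigma> / (4 * real t) * real (card A))" by simp
    also have "\<dots> \<le> real t * (\<sigma> / (4 * real t) * real (card A))"
      using S(6) par t1 by (intro mult_right_mono) auto
    also have "\<dots> = \<sigma> * real (card A) / 4" using t1 by simp
    finally have D: "real (card ?D) \<le> real (card (X1 i)) / 4" using X1[of i] i by auto
    have "X1 i \<subseteq> Y1 i \<union> ?D" unfolding Y1_def using X1[of i] i by auto
    then have "card (X1 i) \<le> card (Y1 i \<union> ?D)"
      using finX1[of i] i fin(1) by (intro card_mono) (auto simp: Y1_def)
    also have "\<dots> \<le> card (Y1 i) + card ?D" by (rule card_Un_le)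
    finally have "real (card (X1 i)) / 2 \<le> real (card (Y1 i))" using D by linarith
    then show ?thesis unfolding Y1_def by auto
  qed
  have Y2: "Y2 x \<subseteq> X2 x \<and> star_gain \<sigma> \<gamma> t * real (card (X2 x)) \<le> real (card (Y2 x))" if x: "x \<in> S2" for x
  proof (cases "x = w")
    case True
    have "\<gamma> * \<rho> / 2 \<le> real m * (\<gamma> * d) / 2"
    proof -
      have "\<gamma> * \<rho> \<le> 1 * \<rho>" using par \<rho>0 by (intro mult_right_mono) auto
      then have "\<gamma> * \<rho> / 2 \<le> h" using \<rho>h \<rho>0 by linarith
      then show ?thesis using mgd by linarith
    qed
    then show ?thesis using Pw True by (auto simp: gain Y2_def min_def)
  next
    case False
    let ?D = "{b\<in>X2 x. \<exists>a\<in>P. R a b}"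
    have fx: "finite (X2 x)" using finX2 x by auto
    have "real (card ?D) \<le> real (card P) * (e * real (card (X2 x)))"
    proof (rule card_union_cols[OF finP fx])
      fix a assume "a \<in> P"
      then have "a \<in> V" using P(1) H_def by auto
      then show "real (card {b\<in>X2 x. R a b}) \<le> e * real (card (X2 x))"
        using x unfolding V_def heavy_def N_def by force
    qed
    also have "\<dots> \<le> real m * (e * real (card (X2 x)))" using P(2) e0 by (intro mult_right_mono) auto
    also have "\<dots> = (real m * d) * (2 * real t / \<sigma>) * real (card (X2 x))" unfolding e_def by simp
    also have "\<dots> \<le> \<sigma> / (4 * real t) * (2 * real t / \<sigma>) * real (card (X2 x))"
      using m_le par by (intro mult_right_mono) auto
    also have "\<dots> = real (card (X2 x)) / 2" using par t1 by simp
    finally have D: "real (card ?D) \<le> real (card (X2 x)) / 2" .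
    have "card (X2 x - ?D) = card (X2 x) - card ?D" "card ?D \<le> card (X2 x)"
      using fx by (auto intro: card_Diff_subset card_mono)
    then have half: "real (card (X2 x)) / 2 \<le> real (card (Y2 x))" using D False unfolding Y2_def by simp
    have "\<gamma> * \<rho> / 2 * real (card (X2 x)) \<le> 1 / 2 * real (card (X2 x))"
      using gain_half by (intro mult_right_mono) auto
    then show ?thesis using half False unfolding gain Y2_def by auto
  qed
  have copy: "\<exists>g1 g2. is_copy R F (insert v S1) (S2 \<union> U) X1 X2 g1 g2"
    if c: "is_copy R F S1 S2 Y1 Y2 f1 f2" for f1 f2
  proof -
    have "f2 w \<in> Y2 w" using c S(2) by (auto simp: is_copy_def)
    then obtain a where a: "a \<in> P" "R a (f2 w)" by (auto simp: Y2_def)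
    then have aH: "a \<in> H" using P(1) by auto
    then obtain q where q: "\<And>u. u \<in> U \<Longrightarrow> q u \<in> Q u \<and> R a (q u)"
      unfolding H_def by (auto simp: bchoice_iff) metis
    have aX: "a \<in> X1 v" using aH by (auto simp: H_def V_def)
    define g1 where "g1 = f1(v := a)"
    define g2 where "g2 x = (if x \<in> U then q x else f2 x)" for x
    have f1: "f1 i \<in> X1 i" "u \<in> U \<Longrightarrow> \<not> R (f1 i) (q u)" if "i \<in> S1" for i u
      using c that Y1[OF that] q X1[of i] by (auto simp: is_copy_def Y1_def subset_iff)
    have f2: "f2 x \<in> X2 x" "R a (f2 x) \<longleftrightarrow> x = w" if "x \<in> S2" for x
    proof -
      have "f2 x \<in> Y2 x" using c that by (auto simp: is_copy_def)
      then show "f2 x \<in> X2 x" "R a (f2 x) \<longleftrightarrow> x = w"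
        using a Y2[OF that] by (auto simp: Y2_def split: if_splits)
    qed
    have qX: "q u \<in> X2 u" if "u \<in> U" for u using q[OF that] Q[OF that] by auto
    have "is_copy R F (insert v S1) (S2 \<union> U) X1 X2 g1 g2"
      unfolding is_copy_def
    proof (intro conjI ballI)
      fix i assume "i \<in> insert v S1"
      then show "g1 i \<in> X1 i" using aX f1(1) by (auto simp: g1_def)
    next
      fix x assume "x \<in> S2 \<union> U"
      then show "g2 x \<in> X2 x" using f2(1) qX by (auto simp: g2_def)
    next
      fix i x assume i: "i \<in> insert v S1" and x: "x \<in> S2 \<union> U"
      show "R (g1 i) (g2 x) \<longleftrightarrow> F i x"
      proof (cases "i = v")
        case True
        then show ?thesis using x F(1,2) f2(2) q by (auto simp: g1_def g2_def)
      next
        case False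
        then have iS: "i \<in> S1" using i by auto
        show ?thesis
        proof (cases "x \<in> U")
          case True
          then show ?thesis using False f1(2)[OF iS True] F(3)[OF iS True] by (auto simp: g1_def g2_def)
        next
          case False
          then have "x \<in> S2" using x by auto
          then show ?thesis using c iS False \<open>i \<noteq> v\<close> by (auto simp: is_copy_def g1_def g2_def)
        qed
      qed
    qed
    then show ?thesis by blast
  qed
  show ?thesis using Y1 Y2 copy by blast
qed

section \<open>Abundance of copies of a tree\<close>

text \<open>
  Trees grown from a single column vertex by attaching pendant stars.  A new row vertex \<open>v\<close> arrives
  together with all its neighbours, so that no later star is attached to it.
\<close>

inductive star_built :: "('t \<Rightarrow> 'u \<Rightarrow> bool) \<Rightarrow> 't set \<Rightarrow> 'u set \<Rightarrow> bool" for F where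
  root: "star_built F {} {w}"
| grow: "star_built F S1 S2 \<Longrightarrow> v \<notin> S1 \<Longrightarrow> w \<in> S2 \<Longrightarrow> finite U \<Longrightarrow> U \<inter> S2 = {} \<Longrightarrow>
    (\<And>x. x \<in> S2 \<Longrightarrow> F v x \<longleftrightarrow> x = w) \<Longrightarrow> (\<And>x. x \<in> U \<Longrightarrow> F v x) \<Longrightarrow>
    (\<And>i x. i \<in> S1 \<Longrightarrow> x \<in> U \<Longrightarrow> \<not> F i x) \<Longrightarrow> star_built F (insert v S1) (S2 \<union> U)"

lemma star_built_finite: "star_built F S1 S2 \<Longrightarrow> finite S1 \<and> finite S2"
  by (induction rule: star_built.induct) auto

text \<open>
  Every removed star raises the level \<open>k\<close> by one, so a tree with \<open>card S1\<close> row vertices left uses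
  only the levels up to \<open>k + card S1\<close>; this is what \<open>J\<close> bounds.
\<close>

lemma abundant_copies:
  fixes d s :: real and \<sigma> \<beta> \<gamma> :: "nat \<Rightarrow> real" and t J :: nat
  assumes fin: "finite A" "finite B" "B \<noteq> {}"
    and col: "\<And>b. b \<in> B \<Longrightarrow> real (card {a\<in>A. R a b}) \<le> d * real (card A)"
    and d: "0 < d"
    and \<sigma>: "\<And>k. 0 < \<sigma> k" "\<And>k. \<sigma> k \<le> 1" "\<And>k. \<sigma> (Suc k) \<le> \<sigma> k / 2"
    and \<gamma>: "\<And>k. 0 < \<gamma> k" "\<And>k. \<gamma> k \<le> 1"
    and \<beta>: "\<And>k. 0 < \<beta> k" "\<And>k. k < J \<Longrightarrow> \<beta> (Suc k) \<le> star_gain (\<sigma> k) (\<gamma> k) t * \<beta> k"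
    and small: "\<And>k. k \<le> J \<Longrightarrow> d \<le> \<sigma> k / (4 * real t)" "\<And>k. k \<le> J \<Longrightarrow> real t * s \<le> \<sigma> k / 4"
    and row: "\<And>k B'. k \<le> J \<Longrightarrow> B' \<subseteq> B \<Longrightarrow> \<beta> k * real (card B) \<le> real (card B') \<Longrightarrow>
      real (card {a\<in>A. real (card {b\<in>B'. R a b}) < \<gamma> k * d * real (card B')}) < s * real (card A)"
    and S: "star_built F S1 S2" "card S2 \<le> t" "k + card S1 \<le> J"
    and X1: "\<And>i. i \<in> S1 \<Longrightarrow> X1 i \<subseteq> A \<and> \<sigma> k * real (card A) \<le> real (card (X1 i))"
    and X2: "\<And>x. x \<in> S2 \<Longrightarrow> X2 x \<subseteq> B \<and> \<beta> k * real (card B) \<le> real (card (X2 x))"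
  shows "\<exists>f1 f2. is_copy R F S1 S2 X1 X2 f1 f2"
  using S X1 X2
proof (induction arbitrary: k X1 X2 rule: star_built.induct)
  case (root w)
  have "0 < \<beta> k * real (card B)" using \<beta>(1) fin by (simp add: card_gt_0_iff)
  then have "0 < real (card (X2 w))" using root(4)[of w] by (meson insertI1 less_le_trans)
  then have "X2 w \<noteq> {}" by auto
  then obtain b where "b \<in> X2 w" by auto
  then show ?case by (intro exI[of _ "\<lambda>_. undefined"] exI[of _ "\<lambda>_. b"]) (simp add: is_copy_def)
next
  case (grow S1 S2 v w U)
  have finS: "finite S1" "finite S2" using star_built_finite[OF grow.hyps(1)] by auto
  have cS: "card S2 + card U \<le> t"
    using grow.prems(1) finS grow.hyps(4,5) by (simp add: card_Un_disjoint Int_commute)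
  have kJ: "Suc k + card S1 \<le> J" using grow.prems(2) finS grow.hyps(2) by simp
  have B0: "0 < real (card B)" using fin by (simp add: card_gt_0_iff)
  have X2ne: "X2 x \<subseteq> B \<and> X2 x \<noteq> {}" if "x \<in> S2 \<union> U" for x
  proof -
    have "0 < \<beta> k * real (card B)" using \<beta>(1) B0 by simp
    then have "0 < real (card (X2 x))" using grow.prems(4)[OF that] by linarith
    then show ?thesis using grow.prems(4)[OF that] by auto
  qed
  have "\<exists>Y1 Y2. (\<forall>i\<in>S1. Y1 i \<subseteq> X1 i \<and> real (card (X1 i)) / 2 \<le> real (card (Y1 i))) \<and>
    (\<forall>x\<in>S2. Y2 x \<subseteq> X2 x \<and> star_gain (\<sigma> k) (\<gamma> k) t * real (card (X2 x)) \<le> real (card (Y2 x))) \<and>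
    (\<forall>f1 f2. is_copy R F S1 S2 Y1 Y2 f1 f2 \<longrightarrow>
      (\<exists>g1 g2. is_copy R F (insert v S1) (S2 \<union> U) X1 X2 g1 g2))"
  proof (rule star_step[OF fin(1,2) col d \<sigma>(1,2) \<gamma>(1,2) small])
    show "real (card {a\<in>A. real (card {b\<in>X2 x. R a b}) < \<gamma> k * d * real (card (X2 x))}) < s * real (card A)"
      if "x \<in> insert w U" for x
    proof (rule row)
      have "x \<in> S2 \<union> U" using that grow.hyps(3) by auto
      then show "X2 x \<subseteq> B" "\<beta> k * real (card B) \<le> real (card (X2 x))" using grow.prems(4) by blast+
    qed (use kJ in simp)
    show "k \<le> J" "k \<le> J" using kJ by simp_all
    show "X1 i \<subseteq> A \<and> \<sigma> k * real (card A) \<le> real (card (X1 i))" if "i \<in> insert v S1" for i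
      using grow.prems(3)[OF that] .
    show "X2 x \<subseteq> B \<and> X2 x \<noteq> {}" if "x \<in> S2 \<union> U" for x using X2ne[OF that] .
  qed (assumption | fact grow.hyps finS cS)+
  then obtain Y1 Y2 where Y1: "\<forall>i\<in>S1. Y1 i \<subseteq> X1 i \<and> real (card (X1 i)) / 2 \<le> real (card (Y1 i))"
    and Y2: "\<forall>x\<in>S2. Y2 x \<subseteq> X2 x \<and> star_gain (\<sigma> k) (\<gamma> k) t * real (card (X2 x)) \<le> real (card (Y2 x))"
    and ext: "\<forall>f1 f2. is_copy R F S1 S2 Y1 Y2 f1 f2 \<longrightarrow>
      (\<exists>g1 g2. is_copy R F (insert v S1) (S2 \<union> U) X1 X2 g1 g2)" by (elim exE conjE) (rule that)
  have gain0: "0 < star_gain (\<sigma> k) (\<gamma> k) t"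
    using \<beta>(1)[of "Suc k"] \<beta>(2)[of k] \<beta>(1)[of k] kJ by (meson Suc_le_lessD add_leD1 less_le_trans zero_less_mult_pos2)
  have "\<exists>f1 f2. is_copy R F S1 S2 Y1 Y2 f1 f2"
  proof (rule grow.IH[OF _ kJ])
    show "card S2 \<le> t" using cS by simp
    fix i assume i: "i \<in> S1"
    have "\<sigma> (Suc k) * real (card A) \<le> \<sigma> k / 2 * real (card A)"
      using \<sigma>(3) by (intro mult_right_mono) auto
    also have "\<dots> \<le> real (card (X1 i)) / 2" using grow.prems(3)[of i] i by simp
    also have "\<dots> \<le> real (card (Y1 i))" using bspec[OF Y1 i] by simp
    finally show "Y1 i \<subseteq> A \<and> \<sigma> (Suc k) * real (card A) \<le> real (card (Y1 i))"
      using bspec[OF Y1 i] grow.prems(3)[of i] i by auto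
  next
    fix x assume x: "x \<in> S2"
    have "\<beta> (Suc k) * real (card B) \<le> star_gain (\<sigma> k) (\<gamma> k) t * \<beta> k * real (card B)"
      using \<beta>(2)[of k] kJ by (intro mult_right_mono) auto
    also have "\<dots> = star_gain (\<sigma> k) (\<gamma> k) t * (\<beta> k * real (card B))" by simp
    also have "\<dots> \<le> star_gain (\<sigma> k) (\<gamma> k) t * real (card (X2 x))"
      using grow.prems(4)[of x] x gain0 by (intro mult_left_mono) auto
    also have "\<dots> \<le> real (card (Y2 x))" using bspec[OF Y2 x] by simp
    finally show "Y2 x \<subseteq> B \<and> \<beta> (Suc k) * real (card B) \<le> real (card (Y2 x))"
      using bspec[OF Y2 x] grow.prems(4)[of x] x by auto
  qed
  then show ?case using ext by blast
qed

lemma rtrancl_simple_path: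
  assumes "(x, y) \<in> {(u, v). P u v}\<^sup>*"
  shows "\<exists>p. p \<noteq> [] \<and> hd p = x \<and> last p = y \<and> distinct p \<and> successively P p \<and>
    (\<forall>z\<in>set p. z = x \<or> (\<exists>u. P u z))"
  using assms
proof (induction rule: rtrancl_induct)
  case base
  show ?case by (rule exI[of _ "[x]"]) simp
next
  case (step y z)
  then obtain p where p: "p \<noteq> []" "hd p = x" "last p = y" "distinct p" "successively P p"
    "\<forall>z\<in>set p. z = x \<or> (\<exists>u. P u z)" by blast
  show ?case
  proof (cases "z \<in> set p")
    case True
    then obtain ys zs where s: "p = ys @ z # zs" by (meson split_list)
    have "successively P (ys @ [z])" using p(5) unfolding s
      by (auto simp: successively_append_iff)
    moreover have "hd (ys @ [z]) = x" using p(2) unfolding s by (cases ys) auto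
    ultimately show ?thesis using p(4,6) unfolding s by (intro exI[of _ "ys @ [z]"]) auto
  next
    case False
    then show ?thesis using p step.hyps(2)
      by (intro exI[of _ "p @ [z]"]) (auto simp: successively_append_iff)
  qed
qed

text \<open>
  A star-built subtree containing all neighbours of its rows can be enlarged until it is everything: otherwise
  connectedness yields an edge leaving it, necessarily from a column to a new row \<open>v\<close>, and by
  acyclicity \<open>v\<close> has no second neighbour inside, so \<open>v\<close> and its other neighbours form a star that
  can be added.
\<close>

lemma tree_star_built:
  assumes T: "is_ordered_tree_bigraph T" and w0: "w0 \<in> part2 T"
  shows "star_built (\<lambda>i x. {i, x} \<in> edges T) (part1 T) (part2 T)"
proof -
  define F where "F i x \<longleftrightarrow> {i, x} \<in> edges T" for i x
  have sym: "F i x \<longleftrightarrow> F x i" for i x by (simp add: F_def insert_commute)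
  have fg: "finite_graph T" and cg: "connected_graph T" and ac: "\<nexists>xs. is_cycle T xs"
    and disj: "part1 T \<inter> part2 T = {}" and un: "part1 T \<union> part2 T = verts T"
    and ed: "\<And>e. e \<in> edges T \<Longrightarrow> \<exists>u\<in>part1 T. \<exists>v\<in>part2 T. e = {u, v}"
    using T unfolding is_ordered_tree_bigraph_def is_tree_def is_ordered_bigraph_def by auto
  have fin: "finite (part1 T)" "finite (part2 T)" using fg un unfolding finite_graph_def
    by (metis finite_Un)+
  have Fpart: "F i x \<Longrightarrow> i \<in> part1 T \<Longrightarrow> x \<in> part2 T" "F i x \<Longrightarrow> i \<in> part2 T \<Longrightarrow> x \<in> part1 T" for i x
    using ed[of "{i, x}"] disj unfolding F_def by (auto simp: doubleton_eq_iff)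
  define r where "r S x y \<longleftrightarrow> F x y \<and> x \<in> S \<and> y \<in> S" for S x y
  define good where "good S1 S2 \<longleftrightarrow> star_built F S1 S2 \<and> S1 \<subseteq> part1 T \<and> S2 \<subseteq> part2 T \<and> w0 \<in> S2 \<and>
    (\<forall>i\<in>S1. \<forall>x. F i x \<longrightarrow> x \<in> S2) \<and> (\<forall>y\<in>S1 \<union> S2. (w0, y) \<in> {(x, y). r (S1 \<union> S2) x y}\<^sup>*)" for S1 S2
  have main: "good S1 S2 \<Longrightarrow> star_built F (part1 T) (part2 T)" for S1 S2
  proof (induction "card (part1 T - S1)" arbitrary: S1 S2 rule: less_induct)
    case less
    let ?S = "S1 \<union> S2"
    have g: "star_built F S1 S2" "S1 \<subseteq> part1 T" "S2 \<subseteq> part2 T" "w0 \<in> S2"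
      "\<And>i x. i \<in> S1 \<Longrightarrow> F i x \<Longrightarrow> x \<in> S2"
      "\<And>y. y \<in> ?S \<Longrightarrow> (w0, y) \<in> {(x, y). r ?S x y}\<^sup>*"
      using less.prems unfolding good_def by blast+
    show ?case
    proof (cases "?S = verts T")
      case True
      then have "S1 = part1 T" "S2 = part2 T" using g(2,3) un disj by blast+
      then show ?thesis using g(1) by simp
    next
      case False
      then obtain z where z: "z \<in> verts T" "z \<notin> ?S" using g(2,3) un by blast
      have "w0 \<in> verts T" using w0 un by auto
      then have "(w0, z) \<in> {(x, y). {x, y} \<in> edges T}\<^sup>*"
        using cg z(1) unfolding connected_graph_def by blast
      then have "z \<in> ?S \<or> (\<exists>x y. x \<in> ?S \<and> y \<notin> ?S \<and> F x y)"
      proof (induction rule: rtrancl_induct)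
        case base
        then show ?case using g(4) by auto
      next
        case (step y z)
        then show ?case by (auto simp: F_def)
      qed
      then obtain w v where wv: "w \<in> ?S" "v \<notin> ?S" "F w v" using z(2) by blast
      then have wS2: "w \<in> S2" using g(5) by auto
      then have v1: "v \<in> part1 T" using Fpart(2)[OF wv(3)] g(3) by auto
      define U where "U = {x. F v x} - {w}"
      have U2: "U \<subseteq> part2 T" using Fpart(1) v1 unfolding U_def by auto
      have finU: "finite U" using U2 fin(2) finite_subset by blast
      \<comment> \<open>A second neighbour of \<open>v\<close> in the connected set would close a cycle.\<close>
      have only: "x = w" if x: "x \<in> S2" "F v x" for x
      proof (rule ccontr)
        assume ne: "x \<noteq> w"
        have sr: "sym {(x, y). r ?S x y}" unfolding sym_def r_def using sym by auto
        have "(w, w0) \<in> {(x, y). r ?S x y}\<^sup>*"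
          using g(6)[of w] wS2 sym_rtrancl[OF sr] unfolding sym_def by auto
        then have "(w, x) \<in> {(x, y). r ?S x y}\<^sup>*" using g(6)[of x] x(1) by (meson UnI2 rtrancl_trans)
        then obtain p where p: "p \<noteq> []" "hd p = w" "last p = x" "distinct p" "successively (r ?S) p"
          "\<forall>z\<in>set p. z = w \<or> (\<exists>u. r ?S u z)"
          using rtrancl_simple_path[of w x "r ?S"] by blast
        have "set p \<subseteq> ?S" using p(6) wS2 by (auto simp: r_def)
        then have vp: "v \<notin> set p" using wv(2) by auto
        have "length p \<noteq> 1" using p(2,3) ne by (auto simp: length_Suc_conv)
        then have len: "2 \<le> length p" using p(1) by (metis One_nat_def Suc_1 Suc_leI le_neq_implies_less length_0_conv length_greater_0_conv)
        have "is_cycle T (p @ [v])"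
          unfolding is_cycle_def
        proof (intro conjI allI impI)
          show "3 \<le> length (p @ [v])" using len by simp
          show "distinct (p @ [v])" using p(4) vp by simp
          fix i assume i: "i < length (p @ [v])"
          consider "Suc i < length p" | "Suc i = length p" | "i = length p" using i by fastforce
          then show "{(p @ [v]) ! i, (p @ [v]) ! (Suc i mod length (p @ [v]))} \<in> edges T"
          proof cases
            case 1
            then have "r ?S (p ! i) (p ! Suc i)" using p(5) by (auto simp: successively_conv_nth)
            then show ?thesis using 1 by (simp add: nth_append r_def F_def)
          next
            case 2
            then have "p ! i = x" using p(1,3) by (metis diff_Suc_1 last_conv_nth)
            then show ?thesis using 2 x(2) sym by (simp add: nth_append F_def insert_commute flip: 2)
          next
            case 3
            have "p ! 0 = w" using p(1,2) by (simp add: hd_conv_nth)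
            then show ?thesis using 3 wv(3) p(1) by (simp add: nth_append F_def insert_commute)
          qed
        qed
        then show False using ac by blast
      qed
      have Fvw: "F v w" using wv(3) sym by blast
      have US: "U \<inter> S2 = {}" using only unfolding U_def by auto
      have built: "star_built F (insert v S1) (S2 \<union> U)"
      proof (rule star_built.grow[OF g(1) _ wS2 finU US])
        show "v \<notin> S1" using wv(2) by auto
        show "F v x \<longleftrightarrow> x = w" if "x \<in> S2" for x using only that Fvw by auto
        show "F v x" if "x \<in> U" for x using that by (simp add: U_def)
        show "\<not> F i x" if "i \<in> S1" "x \<in> U" for i x using that g(5) US by blast
      qed
      let ?S' = "insert v S1 \<union> (S2 \<union> U)"
      have mono: "{(x, y). r ?S x y}\<^sup>* \<subseteq> {(x, y). r ?S' x y}\<^sup>*"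
        by (rule rtrancl_mono) (auto simp: r_def)
      have rv: "(w0, v) \<in> {(x, y). r ?S' x y}\<^sup>*"
      proof -
        have "(w0, w) \<in> {(x, y). r ?S' x y}\<^sup>*" using g(6)[of w] wS2 mono by blast
        moreover have "(w, v) \<in> {(x, y). r ?S' x y}" using wv wS2 by (auto simp: r_def)
        ultimately show ?thesis by (rule rtrancl_into_rtrancl)
      qed
      have "good (insert v S1) (S2 \<union> U)"
        unfolding good_def
      proof (intro conjI ballI allI impI)
        fix i x assume "i \<in> insert v S1" "F i x"
        then show "x \<in> S2 \<union> U" using g(5) wS2 by (auto simp: U_def)
      next
        fix y assume y: "y \<in> ?S'"
        show "(w0, y) \<in> {(x, y). r ?S' x y}\<^sup>*"
        proof (cases "y \<in> U")
          case True
          then have "(v, y) \<in> {(x, y). r ?S' x y}" by (auto simp: r_def U_def)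
          then show ?thesis using rv by (meson rtrancl_into_rtrancl)
        next
          case False
          then show ?thesis using y rv g(6)[of y] mono by blast
        qed
      qed (use built g v1 U2 in auto)
      moreover have "card (part1 T - insert v S1) < card (part1 T - S1)"
        using fin(1) v1 wv(2) by (intro psubset_card_mono) auto
      ultimately show ?thesis using less.hyps by blast
    qed
  qed
  have "good {} {w0}" unfolding good_def using w0 by (auto intro: star_built.root)
  then show ?thesis using main by (simp add: F_def[abs_def])
qed

section \<open>Order intervals\<close>

lemma linear_order_rank:
  assumes "linear_order_on V r" "finite A" "A \<subseteq> V"
  defines "rk \<equiv> \<lambda>a. card {a'\<in>A. (a', a) \<in> r \<and> a' \<noteq> a}"
  shows "bij_betw rk A {..<card A}"
    and "\<And>a b. a \<in> A \<Longrightarrow> b \<in> A \<Longrightarrow> rk a < rk b \<longleftrightarrow> (a, b) \<in> r \<and> a \<noteq> b"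
proof -
  have tr: "trans r" and an: "antisym r" and tot: "total_on V r"
    using assms(1) by (auto simp: linear_order_on_def partial_order_on_def preorder_on_def)
  have mono: "rk a < rk b" if "a \<in> A" "b \<in> A" "(a, b) \<in> r" "a \<noteq> b" for a b
    unfolding rk_def
  proof (rule psubset_card_mono)
    show "finite {a' \<in> A. (a', b) \<in> r \<and> a' \<noteq> b}" using assms(2) by simp
    have "{a' \<in> A. (a', a) \<in> r \<and> a' \<noteq> a} \<subseteq> {a' \<in> A. (a', b) \<in> r \<and> a' \<noteq> b}"
      using that tr an by (auto dest: transD antisymD)
    moreover have "a \<in> {a' \<in> A. (a', b) \<in> r \<and> a' \<noteq> b}" using that by simp
    ultimately show "{a' \<in> A. (a', a) \<in> r \<and> a' \<noteq> a} \<subset> {a' \<in> A. (a', b) \<in> r \<and> a' \<noteq> b}" by auto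
  qed
  have tot': "(a, b) \<in> r \<or> (b, a) \<in> r" if "a \<in> A" "b \<in> A" "a \<noteq> b" for a b
    using tot that assms(3) by (auto simp: total_on_def)
  show iff: "rk a < rk b \<longleftrightarrow> (a, b) \<in> r \<and> a \<noteq> b" if "a \<in> A" "b \<in> A" for a b
    using mono[of a b] mono[of b a] tot'[of a b] that by fastforce
  have inj: "inj_on rk A"
  proof (rule inj_onI)
    fix a b assume "a \<in> A" "b \<in> A" "rk a = rk b"
    then show "a = b" using mono[of a b] mono[of b a] tot'[of a b] by fastforce
  qed
  have sub: "rk ` A \<subseteq> {..<card A}"
  proof
    fix n assume "n \<in> rk ` A"
    then obtain a where a: "a \<in> A" "n = rk a" by auto
    have "{a' \<in> A. (a', a) \<in> r \<and> a' \<noteq> a} \<subset> A" using a(1) by auto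
    then show "n \<in> {..<card A}" using a(2) assms(2) unfolding rk_def by (simp add: psubset_card_mono)
  qed
  have "rk ` A = {..<card A}" by (rule card_subset_eq) (use sub inj in \<open>auto simp: card_image\<close>)
  then show "bij_betw rk A {..<card A}" using inj by (simp add: bij_betw_def)
qed

text \<open>
  Cutting \<open>A\<close> by rank into consecutive pieces reduces the order requirement on copies to the choice
  of one vertex from each piece.
\<close>

lemma interval_blocks:
  assumes "linear_order_on P p" "finite P" "linear_order_on V r" "finite A" "A \<subseteq> V" "card P \<le> K"
  shows "\<exists>X. (\<forall>i\<in>P. X i \<subseteq> A \<and> card (X i) = card A div K) \<and>
    (\<forall>i\<in>P. \<forall>j\<in>P. \<forall>a\<in>X i. \<forall>b\<in>X j. (i, j) \<in> p \<and> i \<noteq> j \<longrightarrow> (a, b) \<in> r \<and> a \<noteq> b)"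
proof -
  define rP where "rP i = card {i'\<in>P. (i', i) \<in> p \<and> i' \<noteq> i}" for i
  define rA where "rA a = card {a'\<in>A. (a', a) \<in> r \<and> a' \<noteq> a}" for a
  note P = linear_order_rank[OF assms(1,2) order_refl, folded rP_def]
  note A = linear_order_rank[OF assms(3-5), folded rA_def]
  define q where "q = card A div K"
  define X where "X i = {a\<in>A. rA a \<in> {q * rP i..<q * rP i + q}}" for i
  have "card (X i) = q" if i: "i \<in> P" for i
  proof -
    have "rP i < card P" using P(1) i by (auto simp: bij_betw_def)
    then have "q * rP i + q \<le> q * K" using assms(6) by (metis Suc_leI le_trans mult_Suc_right add.commute mult_le_mono2)
    also have "\<dots> \<le> card A" unfolding q_def by (metis div_times_less_eq_dividend)
    finally have "{q * rP i..<q * rP i + q} \<subseteq> {..<card A}" by auto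
    then have "rA ` X i = {q * rP i..<q * rP i + q}"
      using A(1) unfolding X_def bij_betw_def by (auto simp: image_iff set_eq_iff subset_iff) metis
    moreover have "inj_on rA (X i)"
      using A(1) unfolding bij_betw_def X_def by (auto intro: inj_on_subset)
    ultimately show ?thesis by (metis card_atLeastLessThan card_image diff_add_inverse)
  qed
  moreover have "(a, b) \<in> r \<and> a \<noteq> b"
    if "i \<in> P" "j \<in> P" "a \<in> X i" "b \<in> X j" "(i, j) \<in> p" "i \<noteq> j" for i j a b
  proof -
    have "rP i < rP j" using P(2) that by simp
    then have "q * rP i + q \<le> q * rP j" by (metis Suc_leI mult_Suc_right add.commute mult_le_mono2)
    then have "rA a < rA b" using that(3,4) unfolding X_def by auto
    then show ?thesis using A(2) that(3,4) unfolding X_def by auto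
  qed
  ultimately show ?thesis unfolding q_def[symmetric] by (intro exI[of _ X]) (auto simp: X_def)
qed

text \<open>
  The form in which an excluded ordered pattern is used: within every pair of
  subsets, some family of equally large candidate sets (in the application, order intervals) contains
  no copy.  This no longer mentions the orders, and it is inherited by subsets.
\<close>

definition copy_free ::
  "('v \<Rightarrow> 'w \<Rightarrow> bool) \<Rightarrow> ('t \<Rightarrow> 'u \<Rightarrow> bool) \<Rightarrow> 't set \<Rightarrow> 'u set \<Rightarrow> nat \<Rightarrow> 'v set \<Rightarrow> 'w set \<Rightarrow> bool" where
  "copy_free R F S1 S2 K A B \<longleftrightarrow> (\<forall>A'\<subseteq>A. \<forall>B'\<subseteq>B. \<exists>X1 X2.
     (\<forall>i\<in>S1. X1 i \<subseteq> A' \<and> card (X1 i) = card A' div K) \<and>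
     (\<forall>x\<in>S2. X2 x \<subseteq> B' \<and> card (X2 x) = card B' div K) \<and>
     (\<nexists>f1 f2. is_copy R F S1 S2 X1 X2 f1 f2))"

lemma copy_freeD:
  assumes "copy_free R F S1 S2 K A B" "A' \<subseteq> A" "B' \<subseteq> B"
  obtains X1 X2 where "\<forall>i\<in>S1. X1 i \<subseteq> A' \<and> card (X1 i) = card A' div K"
    "\<forall>x\<in>S2. X2 x \<subseteq> B' \<and> card (X2 x) = card B' div K" "\<nexists>f1 f2. is_copy R F S1 S2 X1 X2 f1 f2"
  using assms(1)[unfolded copy_free_def, THEN spec, THEN mp, OF assms(2), THEN spec, THEN mp, OF assms(3)]
  by (elim exE conjE) (rule that)

lemma copy_free_mono:
  assumes "copy_free R F S1 S2 K A B" "A' \<subseteq> A" "B' \<subseteq> B"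
  shows "copy_free R F S1 S2 K A' B'"
  unfolding copy_free_def
proof (intro allI impI)
  fix A'' B'' assume "A'' \<subseteq> A'" "B'' \<subseteq> B'"
  then have "A'' \<subseteq> A" "B'' \<subseteq> B" using assms(2,3) by auto
  then show "\<exists>X1 X2. (\<forall>i\<in>S1. X1 i \<subseteq> A'' \<and> card (X1 i) = card A'' div K) \<and>
     (\<forall>x\<in>S2. X2 x \<subseteq> B'' \<and> card (X2 x) = card B'' div K) \<and>
     (\<nexists>f1 f2. is_copy R F S1 S2 X1 X2 f1 f2)"
    by (rule assms(1)[unfolded copy_free_def, THEN spec, THEN mp, THEN spec, THEN mp])
qed

abbreviation adj :: "('a, 'x) graph_scheme \<Rightarrow> 'a \<Rightarrow> 'a \<Rightarrow> bool" where
  "adj G u v \<equiv> {u, v} \<in> edges G"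

lemma is_copy_contained:
  fixes G :: "'b obigraph" and T :: "'a obigraph"
  assumes G: "is_ordered_bigraph G" and T: "is_ordered_bigraph T"
    and sub: "\<And>i. i \<in> part1 T \<Longrightarrow> X1 i \<subseteq> part1 G" "\<And>x. x \<in> part2 T \<Longrightarrow> X2 x \<subseteq> part2 G"
    and mono1: "\<And>i j a b. i \<in> part1 T \<Longrightarrow> j \<in> part1 T \<Longrightarrow> a \<in> X1 i \<Longrightarrow> b \<in> X1 j \<Longrightarrow>
      (i, j) \<in> ord1 T \<Longrightarrow> i \<noteq> j \<Longrightarrow> (a, b) \<in> ord1 G \<and> a \<noteq> b"
    and mono2: "\<And>i j a b. i \<in> part2 T \<Longrightarrow> j \<in> part2 T \<Longrightarrow> a \<in> X2 i \<Longrightarrow> b \<in> X2 j \<Longrightarrow>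
      (i, j) \<in> ord2 T \<Longrightarrow> i \<noteq> j \<Longrightarrow> (a, b) \<in> ord2 G \<and> a \<noteq> b"
    and copy: "is_copy (adj G) (adj T) (part1 T) (part2 T) X1 X2 f1 f2"
  shows "contains_obigraph G T"
proof -
  have un: "part1 T \<union> part2 T = verts T" "part1 T \<inter> part2 T = {}"
    "part1 G \<union> part2 G = verts G" "part1 G \<inter> part2 G = {}"
    using G T unfolding is_ordered_bigraph_def by auto
  have edT: "e \<in> edges T \<Longrightarrow> \<exists>u\<in>part1 T. \<exists>v\<in>part2 T. e = {u, v}" for e
    using T unfolding is_ordered_bigraph_def by blast
  have edG: "e \<in> edges G \<Longrightarrow> \<exists>u\<in>part1 G. \<exists>v\<in>part2 G. e = {u, v}" for e
    using G unfolding is_ordered_bigraph_def by blast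
  have lin: "linear_order_on (part1 T) (ord1 T)" "linear_order_on (part2 T) (ord2 T)"
    "linear_order_on (part1 G) (ord1 G)" "linear_order_on (part2 G) (ord2 G)"
    using G T unfolding is_ordered_bigraph_def by auto
  define f where "f x = (if x \<in> part1 T then f1 x else f2 x)" for x
  have fX1: "f i \<in> X1 i" "f i \<in> part1 G" if "i \<in> part1 T" for i
    using that copy sub(1)[OF that] unfolding is_copy_def f_def by auto
  have fX2: "f x \<in> X2 x" "f x \<in> part2 G" if "x \<in> part2 T" for x
    using that copy sub(2)[OF that] un(2) unfolding is_copy_def f_def by auto
  have adj12: "adj G (f i) (f x) \<longleftrightarrow> adj T i x" if "i \<in> part1 T" "x \<in> part2 T" for i x
    using that copy un(2) unfolding is_copy_def f_def by auto
  have order_transfer: "((u, v) \<in> p \<longleftrightarrow> (g u, g v) \<in> r) \<and> (u \<noteq> v \<longrightarrow> g u \<noteq> g v)"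
    if "linear_order_on P p" "linear_order_on V r" "u \<in> P" "v \<in> P" "g u \<in> V" "g v \<in> V"
      and m: "\<And>i j. i \<in> P \<Longrightarrow> j \<in> P \<Longrightarrow> (i, j) \<in> p \<Longrightarrow> i \<noteq> j \<Longrightarrow> (g i, g j) \<in> r \<and> g i \<noteq> g j"
    for P :: "'a set" and p and V :: "'b set" and r u v and g :: "'a \<Rightarrow> 'b"
  proof (cases "u = v")
    case True
    then show ?thesis using that(1-6)
      by (auto simp: linear_order_on_def partial_order_on_def preorder_on_def refl_on_def)
  next
    case False
    have "(u, v) \<in> p \<or> (v, u) \<in> p" using that(1,3,4) False by (auto simp: linear_order_on_def total_on_def)
    moreover have "antisym p" "antisym r" using that(1,2) by (auto simp: linear_order_on_def partial_order_on_def)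
    ultimately show ?thesis using m[of u v] m[of v u] False that(3,4) by (auto dest: antisymD)
  qed
  have o1: "((u, v) \<in> ord1 T \<longleftrightarrow> (f u, f v) \<in> ord1 G) \<and> (u \<noteq> v \<longrightarrow> f u \<noteq> f v)"
    if "u \<in> part1 T" "v \<in> part1 T" for u v
    by (rule order_transfer[OF lin(1,3)]) (use that fX1 mono1 in auto)
  have o2: "((u, v) \<in> ord2 T \<longleftrightarrow> (f u, f v) \<in> ord2 G) \<and> (u \<noteq> v \<longrightarrow> f u \<noteq> f v)"
    if "u \<in> part2 T" "v \<in> part2 T" for u v
    by (rule order_transfer[OF lin(2,4)]) (use that fX2 mono2 in auto)
  have inj: "inj_on f (verts T)"
  proof (rule inj_onI)
    fix u v assume uv: "u \<in> verts T" "v \<in> verts T" "f u = f v"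
    have "f u \<noteq> f v" if "u \<in> part1 T" "v \<in> part2 T" for u v
      using fX1(2)[OF that(1)] fX2(2)[OF that(2)] un(4) by auto
    then have "u \<in> part1 T \<longleftrightarrow> v \<in> part1 T" using uv un(1) by (metis Un_iff)
    then show "u = v" using o1[of u v] o2[of u v] uv un(1) by blast
  qed
  have adj_iff: "adj T u v \<longleftrightarrow> adj G (f u) (f v)" if uv: "u \<in> verts T" "v \<in> verts T" for u v
  proof -
    have "u \<in> part1 T \<or> u \<in> part2 T" "v \<in> part1 T \<or> v \<in> part2 T" using uv un(1) by auto
    then consider "u \<in> part1 T" "v \<in> part2 T" | "u \<in> part2 T" "v \<in> part1 T"
      | "u \<in> part1 T" "v \<in> part1 T" | "u \<in> part2 T" "v \<in> part2 T" by blast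
    then show ?thesis
    proof cases
      case 1 then show ?thesis using adj12 by simp
    next
      case 2 then show ?thesis using adj12[of v u] by (simp add: insert_commute)
    next
      case 3
      then have "\<not> adj T u v" using edT[of "{u, v}"] un(2) by (auto simp: doubleton_eq_iff)
      moreover have "f u \<notin> part2 G" "f v \<notin> part2 G" using fX1(2)[of u] fX1(2)[of v] 3 un(4) by auto
      then have "\<not> adj G (f u) (f v)" using edG[of "{f u, f v}"] by (auto simp: doubleton_eq_iff)
      ultimately show ?thesis by simp
    next
      case 4
      then have "\<not> adj T u v" using edT[of "{u, v}"] un(2) by (auto simp: doubleton_eq_iff)
      moreover have "f u \<notin> part1 G" "f v \<notin> part1 G" using fX2(2)[of u] fX2(2)[of v] 4 un(4) by auto
      then have "\<not> adj G (f u) (f v)" using edG[of "{f u, f v}"] by (auto simp: doubleton_eq_iff)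
      ultimately show ?thesis by simp
    qed
  qed
  define H :: "'b graph" where "H = \<lparr>verts = f ` verts T, edges = {e \<in> edges G. e \<subseteq> f ` verts T}\<rparr>"
  have "f ` verts T \<subseteq> verts G" using fX1(2) fX2(2) un(1,3) by blast
  then have "is_induced_subgraph H G" unfolding is_induced_subgraph_def H_def by simp
  moreover have "is_graph_iso f T H"
    unfolding is_graph_iso_def H_def using inj adj_iff by (auto simp: bij_betw_def)
  ultimately show ?thesis
    unfolding contains_obigraph_def using fX1(2) fX2(2) o1 o2 by (intro exI[of _ H] exI[of _ f]) auto
qed

lemma obigraph_copy_free:
  fixes G :: "'b obigraph" and T :: "'a obigraph"
  assumes G: "is_ordered_bigraph G" and T: "is_ordered_bigraph T" and free: "\<not> contains_obigraph G T"
    and K: "card (verts T) \<le> K"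
  shows "copy_free (adj G) (adj T) (part1 T) (part2 T) K (part1 G) (part2 G)"
  unfolding copy_free_def
proof (intro allI impI)
  fix A B assume sub: "A \<subseteq> part1 G" "B \<subseteq> part2 G"
  have fin: "finite (verts T)" "finite (verts G)" "part1 T \<union> part2 T = verts T" "part1 G \<union> part2 G = verts G"
    and lin: "linear_order_on (part1 T) (ord1 T)" "linear_order_on (part2 T) (ord2 T)"
    "linear_order_on (part1 G) (ord1 G)" "linear_order_on (part2 G) (ord2 G)"
    using G T unfolding is_ordered_bigraph_def finite_graph_def by auto
  have finP: "finite (part1 T)" "finite (part2 T)" "finite A" "finite B"
    using fin sub by (metis Un_iff finite_subset subsetI order_trans)+
  have "card (part1 T) \<le> card (verts T)" "card (part2 T) \<le> card (verts T)"
    using fin by (auto intro: card_mono)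
  then have cK: "card (part1 T) \<le> K" "card (part2 T) \<le> K" using K by auto
  obtain X1 where X1: "\<forall>i\<in>part1 T. X1 i \<subseteq> A \<and> card (X1 i) = card A div K"
    "\<forall>i\<in>part1 T. \<forall>j\<in>part1 T. \<forall>a\<in>X1 i. \<forall>b\<in>X1 j. (i, j) \<in> ord1 T \<and> i \<noteq> j \<longrightarrow> (a, b) \<in> ord1 G \<and> a \<noteq> b"
    using interval_blocks[OF lin(1) finP(1) lin(3) finP(3) sub(1) cK(1)] by blast
  obtain X2 where X2: "\<forall>i\<in>part2 T. X2 i \<subseteq> B \<and> card (X2 i) = card B div K"
    "\<forall>i\<in>part2 T. \<forall>j\<in>part2 T. \<forall>a\<in>X2 i. \<forall>b\<in>X2 j. (i, j) \<in> ord2 T \<and> i \<noteq> j \<longrightarrow> (a, b) \<in> ord2 G \<and> a \<noteq> b"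
    using interval_blocks[OF lin(2) finP(2) lin(4) finP(4) sub(2) cK(2)] by blast
  have "\<nexists>f1 f2. is_copy (adj G) (adj T) (part1 T) (part2 T) X1 X2 f1 f2"
  proof
    assume "\<exists>f1 f2. is_copy (adj G) (adj T) (part1 T) (part2 T) X1 X2 f1 f2"
    then obtain f1 f2 where "is_copy (adj G) (adj T) (part1 T) (part2 T) X1 X2 f1 f2" by blast
    moreover have "X1 i \<subseteq> part1 G" if "i \<in> part1 T" for i using X1(1) sub(1) that by blast
    moreover have "X2 x \<subseteq> part2 G" if "x \<in> part2 T" for x using X2(1) sub(2) that by blast
    moreover have "(a, b) \<in> ord1 G \<and> a \<noteq> b"
      if "i \<in> part1 T" "j \<in> part1 T" "a \<in> X1 i" "b \<in> X1 j" "(i, j) \<in> ord1 T" "i \<noteq> j" for i j a b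
      using X1(2) that by simp
    moreover have "(a, b) \<in> ord2 G \<and> a \<noteq> b"
      if "i \<in> part2 T" "j \<in> part2 T" "a \<in> X2 i" "b \<in> X2 j" "(i, j) \<in> ord2 T" "i \<noteq> j" for i j a b
      using X2(2) that by simp
    ultimately have "contains_obigraph G T"
      using is_copy_contained[OF G T, of X1 X2 f1 f2] by simp
    then show False using free by simp
  qed
  then show "\<exists>X1 X2. (\<forall>i\<in>part1 T. X1 i \<subseteq> A \<and> card (X1 i) = card A div K) \<and>
    (\<forall>x\<in>part2 T. X2 x \<subseteq> B \<and> card (X2 x) = card B div K) \<and>
    (\<nexists>f1 f2. is_copy (adj G) (adj T) (part1 T) (part2 T) X1 X2 f1 f2)"
    using X1(1) X2(1) by blast
qed

section \<open>Embedding in regular pairs\<close>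

lemma edge_count_split:
  assumes "finite A" "finite B" "D \<subseteq> A" "Y \<subseteq> B"
  shows "edge_count R A B = edge_count R D Y + edge_count R (A - D) Y + edge_count R A (B - Y)"
proof -
  have "edge_count R A B = edge_count R A Y + edge_count R A (B - Y)"
    unfolding edge_count_def by (simp only: card_filter_split[OF assms(2,4)] sum.distrib)
  moreover have "edge_count R A Y = edge_count R (A - D) Y + edge_count R D Y"
    unfolding edge_count_def using assms by (intro sum.subset_diff)
  ultimately show ?thesis by simp
qed

text \<open>
  The lower density bound implies an upper one: if many rows saw almost all of \<open>Y\<close>, this would exceed
  the average density by so much that the rest of the pair, which obeys the lower bound, could not
  compensate for it.
\<close>

lemma regular_pair_rows:
  fixes p \<eta> \<theta> s :: real
  assumes fin: "finite A" "finite B" "A \<noteq> {}" "B \<noteq> {}"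
    and up: "real (edge_count R A B) \<le> p * real (card A) * real (card B)"
    and low: "\<And>A' B'. A' \<subseteq> A \<Longrightarrow> B' \<subseteq> B \<Longrightarrow> s * real (card A) \<le> real (card A') \<Longrightarrow> s * real (card B) \<le> real (card B') \<Longrightarrow>
      (p - \<eta>) * real (card A') * real (card B') \<le> real (edge_count R A' B')"
    and par: "0 < s" "s \<le> 1/2" "0 < \<theta>" "\<theta> \<le> p - \<eta>" "\<eta> < s\<^sup>2 * (1 - \<theta> - p)" "0 \<le> \<eta>"
    and X: "X \<subseteq> A" "real (card X) \<le> real (card A) / 2"
    and Y: "Y \<subseteq> B" "s * real (card B) \<le> real (card Y)" "real (card Y) \<le> real (card B) / 2"
  shows "real (card {a\<in>X. real (card {b\<in>Y. R a b}) < \<theta> * real (card Y)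
      \<or> (1 - \<theta>) * real (card Y) < real (card {b\<in>Y. R a b})}) < 2 * s * real (card A)"
proof -
  have A0: "0 < real (card A)" "0 < real (card B)" using fin by (simp_all add: card_gt_0_iff)
  then have Y0: "0 < real (card Y)" using Y(2) par(1) by (meson less_le_trans mult_pos_pos)
  define L where "L = {a\<in>X. real (card {b\<in>Y. R a b}) < \<theta> * real (card Y)}"
  define H where "H = {a\<in>X. (1 - \<theta>) * real (card Y) < real (card {b\<in>Y. R a b})}"
  have sub: "L \<subseteq> A" "H \<subseteq> A" using X(1) unfolding L_def H_def by auto
  have finLH: "finite L" "finite H" using sub fin(1) finite_subset by blast+
  have L: "real (card L) < s * real (card A)"
  proof (rule ccontr)
    assume "\<not> ?thesis"
    then have big: "s * real (card A) \<le> real (card L)" by simp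
    then have "0 < real (card L)" using A0 par(1) by (meson less_le_trans mult_pos_pos)
    then have ne: "L \<noteq> {}" by auto
    have "real (edge_count R L Y) = (\<Sum>a\<in>L. real (card {b\<in>Y. R a b}))" by (simp add: edge_count_def)
    also have "\<dots> < (\<Sum>a\<in>L. \<theta> * real (card Y))"
      using finLH(1) ne by (intro sum_strict_mono) (auto simp: L_def)
    also have "\<dots> = \<theta> * (real (card L) * real (card Y))" by simp
    also have "\<dots> \<le> (p - \<eta>) * (real (card L) * real (card Y))" using par(4) by (intro mult_right_mono) auto
    also have "\<dots> \<le> real (edge_count R L Y)" using low[OF sub(1) Y(1) big Y(2)] by (simp add: mult.assoc)
    finally show False by simp
  qed
  have H: "real (card H) < s * real (card A)"
  proof (rule ccontr)
    assume "\<not> ?thesis"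
    then have big: "s * real (card A) \<le> real (card H)" by simp
    have cH: "real (card H) \<le> real (card A) / 2"
      using X card_mono[of X H] finite_subset[OF X(1) fin(1)] unfolding H_def by force
    have cd: "real (card (A - H)) = real (card A) - real (card H)" "real (card (B - Y)) = real (card B) - real (card Y)"
      using card_Diff_subset[OF finLH(2) sub(2)] card_mono[OF fin(1) sub(2)]
        card_Diff_subset[OF finite_subset[OF Y(1) fin(2)] Y(1)] card_mono[OF fin(2) Y(1)] by simp_all
    have s2: "s * real (card A) \<le> real (card A) / 2" "s * real (card B) \<le> real (card B) / 2"
      using par(2) A0 mult_right_mono[of s "1/2" "real (card A)"] mult_right_mono[of s "1/2" "real (card B)"] by auto
    have e1: "(1 - \<theta>) * (real (card H) * real (card Y)) \<le> real (edge_count R H Y)"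
    proof -
      have "(\<Sum>a\<in>H. (1 - \<theta>) * real (card Y)) \<le> (\<Sum>a\<in>H. real (card {b\<in>Y. R a b}))"
        by (rule sum_mono) (simp add: H_def)
      then show ?thesis by (simp add: edge_count_def mult_ac)
    qed
    have e2: "(p - \<eta>) * real (card (A - H)) * real (card Y) \<le> real (edge_count R (A - H) Y)"
      by (rule low) (use Y cH s2 cd in auto)
    have "s * real (card A) \<le> real (card A)" using s2 A0 by linarith
    then have e3: "(p - \<eta>) * real (card A) * real (card (B - Y)) \<le> real (edge_count R A (B - Y))"
      by (intro low) (use Y s2 cd in auto)
    have "(1 - \<theta>) * (real (card H) * real (card Y)) + (p - \<eta>) * (real (card A) - real (card H)) * real (card Y)
        + (p - \<eta>) * real (card A) * (real (card B) - real (card Y)) \<le> p * real (card A) * real (card B)"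
      using e1 e2 e3 up edge_count_split[OF fin(1,2) sub(2) Y(1), of R] unfolding cd by simp
    then have gap: "(1 - \<theta> - p + \<eta>) * (real (card H) * real (card Y)) \<le> \<eta> * (real (card A) * real (card B))"
      by (simp add: algebra_simps)
    have "0 < s\<^sup>2 * (1 - \<theta> - p)" using par(5,6) by linarith
    then have pos: "0 < 1 - \<theta> - p" using par(1) by (auto simp: zero_less_mult_iff)
    have "s\<^sup>2 * (real (card A) * real (card B)) = (s * real (card A)) * (s * real (card B))"
      by (simp add: power2_eq_square)
    also have "\<dots> \<le> real (card H) * real (card Y)" using big Y(2) par(1) by (intro mult_mono) auto
    finally have "(1 - \<theta> - p) * (s\<^sup>2 * (real (card A) * real (card B))) \<le> (1 - \<theta> - p) * (real (card H) * real (card Y))"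
      using pos by (intro mult_left_mono) auto
    also have "\<dots> \<le> (1 - \<theta> - p + \<eta>) * (real (card H) * real (card Y))"
      using par(6) by (intro mult_right_mono) auto
    finally have "(s\<^sup>2 * (1 - \<theta> - p)) * (real (card A) * real (card B)) \<le> \<eta> * (real (card A) * real (card B))"
      using gap by (simp add: mult_ac)
    moreover have "0 < real (card A) * real (card B)" using A0 by simp
    ultimately show False using par(5) by (meson mult_le_cancel_right_pos not_le)
  qed
  have eq: "{a\<in>X. real (card {b\<in>Y. R a b}) < \<theta> * real (card Y)
      \<or> (1 - \<theta>) * real (card Y) < real (card {b\<in>Y. R a b})} = L \<union> H" unfolding L_def H_def by auto
  have "real (card (L \<union> H)) \<le> real (card L) + real (card H)"
    by (metis card_Un_le of_nat_add of_nat_le_iff)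
  also have "\<dots> < s * real (card A) + s * real (card A)" using L H by (rule add_strict_mono)
  finally show ?thesis unfolding eq by simp
qed

text \<open>
  All row vertices are chosen first.  Each choice splits the candidate set of every column vertex into
  a neighbour and a non-neighbour part, both of proportion at least \<open>\<theta>\<close>, so the part prescribed by the
  pattern stays large, and the column vertices can be picked at the end.
\<close>

lemma regular_pair_copy:
  fixes p \<eta> \<theta> s :: real
  assumes fin: "finite A" "finite B" "A \<noteq> {}" "B \<noteq> {}"
    and up: "real (edge_count R A B) \<le> p * real (card A) * real (card B)"
    and low: "\<And>A' B'. A' \<subseteq> A \<Longrightarrow> B' \<subseteq> B \<Longrightarrow> s * real (card A) \<le> real (card A') \<Longrightarrow> s * real (card B) \<le> real (card B') \<Longrightarrow>
      (p - \<eta>) * real (card A') * real (card B') \<le> real (edge_count R A' B')"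
    and par: "0 < s" "s \<le> 1/2" "0 < \<theta>" "\<theta> \<le> 1" "\<theta> \<le> p - \<eta>" "\<eta> < s\<^sup>2 * (1 - \<theta> - p)" "0 \<le> \<eta>"
    and S: "finite S1" "finite S2" "card S1 \<le> t" "card S2 \<le> t"
    and X1: "\<And>i. i \<in> S1 \<Longrightarrow> X1 i \<subseteq> A \<and> real (card (X1 i)) \<le> real (card A) / 2 \<and>
      real t * (2 * s * real (card A)) < real (card (X1 i))"
    and X2: "\<And>x. x \<in> S2 \<Longrightarrow> X2 x \<subseteq> B \<and> real (card (X2 x)) \<le> real (card B) / 2 \<and>
      s * real (card B) \<le> \<theta> ^ t * real (card (X2 x))"
  shows "\<exists>f1 f2. is_copy R F S1 S2 X1 X2 f1 f2"
proof -
  have A0: "0 < real (card A)" "0 < real (card B)" using fin by (simp_all add: card_gt_0_iff)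
  have "\<exists>f1. (\<forall>i\<in>I. f1 i \<in> X1 i) \<and>
    (\<forall>x\<in>S2. \<theta> ^ card I * real (card (X2 x)) \<le> real (card {b\<in>X2 x. \<forall>i\<in>I. R (f1 i) b \<longleftrightarrow> F i x}))"
    if "I \<subseteq> S1" for I
    using finite_subset[OF that S(1)] that
  proof (induction I rule: finite_induct)
    case empty
    then show ?case by simp
  next
    case (insert i I)
    then obtain f1 where f1: "\<forall>i\<in>I. f1 i \<in> X1 i"
      and f2: "\<forall>x\<in>S2. \<theta> ^ card I * real (card (X2 x)) \<le> real (card {b\<in>X2 x. \<forall>i\<in>I. R (f1 i) b \<longleftrightarrow> F i x})" by auto
    define Y where "Y x = {b\<in>X2 x. \<forall>i\<in>I. R (f1 i) b \<longleftrightarrow> F i x}" for x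
    have iS: "i \<in> S1" using insert.prems by simp
    define bad where "bad x = {a\<in>X1 i. real (card {b\<in>Y x. R a b}) < \<theta> * real (card (Y x))
      \<or> (1 - \<theta>) * real (card (Y x)) < real (card {b\<in>Y x. R a b})}" for x
    have finX: "finite (X1 i)" using X1[OF iS] fin(1) finite_subset by blast
    have cI: "card I \<le> t"
      using card_mono[OF S(1), of I] insert.prems S(3) by simp
    have bad: "real (card (bad x)) \<le> 2 * s * real (card A)" if x: "x \<in> S2" for x
      unfolding bad_def
    proof (rule less_imp_le, rule regular_pair_rows[OF fin up low par(1-3,5-7)])
      show "X1 i \<subseteq> A" "real (card (X1 i)) \<le> real (card A) / 2" using X1[OF iS] by auto
      show "Y x \<subseteq> B" using X2[OF x] unfolding Y_def by auto
      have "card (Y x) \<le> card (X2 x)"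
        using X2[OF x] fin(2) unfolding Y_def by (intro card_mono) (auto intro: finite_subset)
      then show "real (card (Y x)) \<le> real (card B) / 2" using X2[OF x] by linarith
      have "\<theta> ^ t * real (card (X2 x)) \<le> \<theta> ^ card I * real (card (X2 x))"
        using cI par by (intro mult_right_mono power_decreasing) auto
      also have "\<dots> \<le> real (card (Y x))" using f2 x unfolding Y_def by simp
      finally show "s * real (card B) \<le> real (card (Y x))" using X2[OF x] by linarith
    qed auto
    have "real (card (\<Union>x\<in>S2. bad x)) \<le> (\<Sum>x\<in>S2. real (card (bad x)))"
      using card_UN_le[OF S(2), of bad] by (simp flip: of_nat_sum)
    also have "\<dots> \<le> (\<Sum>x\<in>S2. 2 * s * real (card A))" by (rule sum_mono) (rule bad)
    also have "\<dots> = real (card S2) * (2 * s * real (card A))" by simp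
    also have "\<dots> \<le> real t * (2 * s * real (card A))"
      using S(4) par A0 by (intro mult_right_mono) auto
    also have "\<dots> < real (card (X1 i))" using X1[OF iS] by simp
    finally have "card (\<Union>x\<in>S2. bad x) < card (X1 i)" by simp
    moreover have "finite (\<Union>x\<in>S2. bad x)" using S(2) finX unfolding bad_def by auto
    ultimately have "\<not> X1 i \<subseteq> (\<Union>x\<in>S2. bad x)" by (meson card_mono not_le)
    then obtain a where a: "a \<in> X1 i" "\<And>x. x \<in> S2 \<Longrightarrow> a \<notin> bad x" by blast
    have new: "\<theta> ^ card (insert i I) * real (card (X2 x)) \<le>
        real (card {b\<in>X2 x. \<forall>j\<in>insert i I. R ((f1(i := a)) j) b \<longleftrightarrow> F j x})" if x: "x \<in> S2" for x
    proof -
      have eq: "{b\<in>X2 x. \<forall>j\<in>insert i I. R ((f1(i := a)) j) b \<longleftrightarrow> F j x} = {b\<in>Y x. R a b \<longleftrightarrow> F i x}"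
        using insert.hyps(2) unfolding Y_def by auto
      have finY: "finite (Y x)" using X2[OF x] fin(2) unfolding Y_def by (auto intro: finite_subset)
      have nb: "\<theta> * real (card (Y x)) \<le> real (card {b\<in>Y x. R a b})"
        "real (card {b\<in>Y x. R a b}) \<le> (1 - \<theta>) * real (card (Y x))"
        using a(2)[OF x] a(1) unfolding bad_def by auto
      have "card {b\<in>Y x. R a b} + card {b\<in>Y x. \<not> R a b} = card (Y x)"
        by (subst card_Un_disjoint[symmetric]) (use finY in \<open>auto intro!: arg_cong[of _ _ card]\<close>)
      then have "\<theta> * real (card (Y x)) \<le> real (card {b\<in>Y x. \<not> R a b})"
        using nb(2) by (simp add: algebra_simps flip: of_nat_add)
      then have "\<theta> * real (card (Y x)) \<le> real (card {b\<in>Y x. R a b \<longleftrightarrow> F i x})" using nb(1) by (cases "F i x") auto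
      moreover have "\<theta> * (\<theta> ^ card I * real (card (X2 x))) \<le> \<theta> * real (card (Y x))"
        using f2 x par(3) unfolding Y_def by (intro mult_left_mono) auto
      ultimately show ?thesis unfolding eq using insert.hyps by simp
    qed
    have "\<forall>j\<in>insert i I. (f1(i := a)) j \<in> X1 j" using f1 a(1) by simp
    then show ?case using new by blast
  qed
  from this[OF subset_refl] obtain f1 where f1: "\<forall>i\<in>S1. f1 i \<in> X1 i"
    and f2: "\<forall>x\<in>S2. \<theta> ^ card S1 * real (card (X2 x)) \<le> real (card {b\<in>X2 x. \<forall>i\<in>S1. R (f1 i) b \<longleftrightarrow> F i x})" by blast
  have "\<exists>b. b \<in> X2 x \<and> (\<forall>i\<in>S1. R (f1 i) b \<longleftrightarrow> F i x)" if x: "x \<in> S2" for x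
  proof -
    have "0 < s * real (card B)" using par(1) A0 by simp
    also have "\<dots> \<le> \<theta> ^ t * real (card (X2 x))" using X2[OF x] by simp
    also have "\<dots> \<le> \<theta> ^ card S1 * real (card (X2 x))"
      using S(3) par by (intro mult_right_mono power_decreasing) auto
    also have "\<dots> \<le> real (card {b\<in>X2 x. \<forall>i\<in>S1. R (f1 i) b \<longleftrightarrow> F i x})" using f2 x by simp
    finally have "{b\<in>X2 x. \<forall>i\<in>S1. R (f1 i) b \<longleftrightarrow> F i x} \<noteq> {}" by (metis card.empty less_irrefl of_nat_0)
    then show ?thesis by auto
  qed
  then obtain f2 where "\<forall>x\<in>S2. f2 x \<in> X2 x \<and> (\<forall>i\<in>S1. R (f1 i) (f2 x) \<longleftrightarrow> F i x)" by metis
  then show ?thesis using f1 unfolding is_copy_def by blast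
qed

section \<open>Reduction to sparse pairs\<close>

lemma div_card_bounds:
  assumes "1 \<le> K" "K \<le> n"
  shows "real n / (2 * real K) \<le> real (n div K)" "real (n div K) \<le> real n / real K"
proof -
  have "n = K * (n div K) + n mod K" by simp
  moreover have "n mod K < K" using assms by simp
  moreover have "1 \<le> n div K" using assms by (simp add: div_greater_zero_iff Suc_leI)
  then have "K \<le> K * (n div K)" by simp
  ultimately have "n \<le> 2 * (K * (n div K))" by linarith
  then have "real n \<le> real (2 * (K * (n div K)))" by (rule of_nat_mono)
  then show "real n / (2 * real K) \<le> real (n div K)" using assms by (simp add: field_simps)
  have "real (n div K * K) \<le> real n" by (intro of_nat_mono) simp
  then show "real (n div K) \<le> real n / real K" using assms by (simp add: field_simps)
qed

text \<open>
  Density decrement: a pair of density at least \<open>\<epsilon>\<close> without a copy is not regular, so the density can be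
  lowered by \<open>\<eta>\<close> at the cost of a constant proportion \<open>s\<close> of both sides, and about \<open>1 / \<eta>\<close> such steps
  suffice.
\<close>

lemma sparse_subpair:
  fixes \<tau> \<epsilon> :: real and t K :: nat
  assumes \<tau>: "0 < \<tau>" "\<tau> \<le> 1" and \<epsilon>: "0 < \<epsilon>" "\<epsilon> \<le> 1" and K: "2 \<le> K"
  shows "\<exists>c>0. \<forall>(R :: 'v \<Rightarrow> 'w \<Rightarrow> bool) (F :: 't \<Rightarrow> 'u \<Rightarrow> bool) S1 S2 A B.
    finite A \<and> finite B \<and> real K \<le> c * real (card A) \<and> real K \<le> c * real (card B) \<and>
    finite S1 \<and> finite S2 \<and> card S1 \<le> t \<and> card S2 \<le> t \<and>
    real (edge_count R A B) \<le> (1 - \<tau>) * real (card A) * real (card B) \<and>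
    copy_free R F S1 S2 K A B \<longrightarrow>
    (\<exists>A'\<subseteq>A. \<exists>B'\<subseteq>B. c * real (card A) \<le> real (card A') \<and> c * real (card B) \<le> real (card B') \<and>
       real (edge_count R A' B') \<le> \<epsilon> * real (card A') * real (card B'))"
proof -
  define \<theta> where "\<theta> = min (\<epsilon> / 2) (\<tau> / 2)"
  have \<theta>: "0 < \<theta>" "\<theta> \<le> 1" "\<theta> \<le> \<epsilon> / 2" "\<theta> \<le> \<tau> / 2" unfolding \<theta>_def using \<tau> \<epsilon> by auto
  define s where "s = \<theta> ^ t / (8 * real K * (real t + 1))"
  have \<theta>t: "0 < \<theta> ^ t" "\<theta> ^ t \<le> 1" using \<theta> by (auto simp: power_le_one)
  have den: "16 \<le> 8 * real K * (real t + 1)" using K mult_mono[of 2 "real K" 1 "real t + 1"] by simp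
  have s0: "0 < s" unfolding s_def using \<theta>t den by simp
  have sx: "s * (8 * real K * (real t + 1)) = \<theta> ^ t" unfolding s_def using den K by simp
  have s_half: "s \<le> 1 / 2"
  proof -
    have "s * 16 \<le> s * (8 * real K * (real t + 1))" using den s0 by (intro mult_left_mono) auto
    then show ?thesis using sx \<theta>t by linarith
  qed
  have s1: "s * (2 * real K) \<le> \<theta> ^ t"
  proof -
    have "2 * real K * 1 \<le> 8 * real K * (real t + 1)" using K by (intro mult_mono) auto
    then have "s * (2 * real K) \<le> s * (8 * real K * (real t + 1))" using s0 by (intro mult_left_mono) auto
    then show ?thesis using sx by simp
  qed
  have s2: "real t * (2 * s) * (2 * real K) < 1"
  proof -
    have "real t * (2 * s) * (2 * real K) = s * (4 * real K * real t)" by simp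
    also have "\<dots> < s * (8 * real K * (real t + 1))"
    proof (rule mult_strict_left_mono[OF _ s0])
      have "4 * real K * real t \<le> 8 * real K * real t" using K by (intro mult_right_mono) auto
      moreover have "8 * real K * real t < 8 * real K * (real t + 1)" using K by (intro mult_strict_left_mono) auto
      ultimately show "4 * real K * real t < 8 * real K * (real t + 1)" by linarith
    qed
    finally show ?thesis using sx \<theta>t by linarith
  qed
  \<comment> \<open>The second bound makes \<open>\<eta>\<close> smaller than the surplus \<open>s\<^sup>2 * (1 - \<theta> - p)\<close> in \<open>regular_pair_rows\<close>.\<close>
  define \<eta> where "\<eta> = min (\<epsilon> / 2) (s\<^sup>2 * \<tau> / 4)"
  have \<eta>: "0 < \<eta>" "\<eta> \<le> \<epsilon> / 2" "\<eta> \<le> s\<^sup>2 * \<tau> / 4" unfolding \<eta>_def using \<epsilon> \<tau> s0 by auto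
  define J where "J = nat \<lceil>1 / \<eta>\<rceil>"
  have J: "1 \<le> real J * \<eta>"
  proof -
    have "1 / \<eta> \<le> real J" unfolding J_def by (rule real_nat_ceiling_ge)
    then show ?thesis using \<eta>(1) by (simp add: field_simps)
  qed
  define c where "c = s ^ J"
  have c0: "0 < c" unfolding c_def using s0 by simp
  show ?thesis
  proof (intro exI[of _ c] conjI allI impI)
    show "0 < c" by (rule c0)
    fix R :: "'v \<Rightarrow> 'w \<Rightarrow> bool" and F :: "'t \<Rightarrow> 'u \<Rightarrow> bool" and S1 S2 A B
    assume "finite A \<and> finite B \<and> real K \<le> c * real (card A) \<and> real K \<le> c * real (card B) \<and>
      finite S1 \<and> finite S2 \<and> card S1 \<le> t \<and> card S2 \<le> t \<and>
      real (edge_count R A B) \<le> (1 - \<tau>) * real (card A) * real (card B) \<and>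
      copy_free R F S1 S2 K A B"
    then have fin: "finite A" "finite B" and big: "real K \<le> c * real (card A)" "real K \<le> c * real (card B)"
      and S: "finite S1" "finite S2" "card S1 \<le> t" "card S2 \<le> t"
      and dens: "real (edge_count R A B) \<le> (1 - \<tau>) * real (card A) * real (card B)"
      and free: "copy_free R F S1 S2 K A B" by auto
    define p where "p j = 1 - \<tau> - real j * \<eta>" for j
    define st where "st j A' B' \<longleftrightarrow> A' \<subseteq> A \<and> B' \<subseteq> B \<and> s ^ j * real (card A) \<le> real (card A') \<and>
      s ^ j * real (card B) \<le> real (card B') \<and>
      real (edge_count R A' B') \<le> p j * real (card A') * real (card B')" for j A' B'
    have step: "\<exists>A'' B''. st (Suc j) A'' B''" if j: "j \<le> J" "\<epsilon> \<le> p j" and st: "st j A' B'" for j A' B'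
    proof (rule ccontr)
      assume no: "\<not> ?thesis"
      have sub: "A' \<subseteq> A" "B' \<subseteq> B" using st unfolding st_def by auto
      have fin': "finite A'" "finite B'" using sub fin finite_subset by blast+
      have sj: "c \<le> s ^ j" unfolding c_def using j s0 s_half by (intro power_decreasing) auto
      have "c * real (card A) \<le> s ^ j * real (card A)" "c * real (card B) \<le> s ^ j * real (card B)"
        using sj by (intro mult_right_mono; simp)+
      then have KA: "K \<le> card A'" "K \<le> card B'" using big st unfolding st_def by linarith+
      then have ne: "A' \<noteq> {}" "B' \<noteq> {}" using K by auto
      have A0: "0 < real (card A')" "0 < real (card B')" using ne fin' by (simp_all add: card_gt_0_iff)
      have low: "(p j - \<eta>) * real (card A'') * real (card B'') \<le> real (edge_count R A'' B'')"
        if "A'' \<subseteq> A'" "B'' \<subseteq> B'" "s * real (card A') \<le> real (card A'')" "s * real (card B') \<le> real (card B'')"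
        for A'' B''
      proof (rule ccontr)
        assume "\<not> ?thesis"
        moreover have "p (Suc j) = p j - \<eta>" unfolding p_def by (simp add: algebra_simps)
        moreover have "s ^ Suc j * real (card A) \<le> real (card A'')" "s ^ Suc j * real (card B) \<le> real (card B'')"
        proof -
          have "s * (s ^ j * real (card A)) \<le> s * real (card A')" "s * (s ^ j * real (card B)) \<le> s * real (card B')"
            using st s0 unfolding st_def by (intro mult_left_mono; simp)+
          then show "s ^ Suc j * real (card A) \<le> real (card A'')" "s ^ Suc j * real (card B) \<le> real (card B'')"
            using that(3,4) by (simp_all add: mult.assoc)
        qed
        ultimately have "st (Suc j) A'' B''" unfolding st_def using that(1,2) sub by auto
        then show False using no by blast
      qed
      obtain X1 X2 where X: "\<forall>i\<in>S1. X1 i \<subseteq> A' \<and> card (X1 i) = card A' div K"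
        "\<forall>x\<in>S2. X2 x \<subseteq> B' \<and> card (X2 x) = card B' div K" "\<nexists>f1 f2. is_copy R F S1 S2 X1 X2 f1 f2"
        using copy_freeD[OF free sub] .
      have pj: "p j \<le> 1 - \<tau>" unfolding p_def using \<eta>(1) by simp
      have gap: "\<eta> < s\<^sup>2 * (1 - \<theta> - p j)"
      proof -
        have "\<tau> / 2 \<le> 1 - \<theta> - p j" using pj \<theta>(4) by linarith
        then have "s\<^sup>2 * (\<tau> / 2) \<le> s\<^sup>2 * (1 - \<theta> - p j)" by (intro mult_left_mono) auto
        moreover have "s\<^sup>2 * \<tau> / 4 < s\<^sup>2 * (\<tau> / 2)" using s0 \<tau> by simp
        ultimately show ?thesis using \<eta>(3) by linarith
      qed
      have half: "real (n div K) \<le> real n / 2" if "K \<le> n" for n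
      proof -
        have "real n / real K \<le> real n / 2" using K by (intro divide_left_mono) auto
        then show ?thesis using div_card_bounds(2)[of K n] that K by linarith
      qed
      have "\<exists>f1 f2. is_copy R F S1 S2 X1 X2 f1 f2"
      proof (rule regular_pair_copy[where p = "p j" and \<eta> = \<eta> and \<theta> = \<theta> and s = s and t = t and A = A' and B = B'])
        show "real (edge_count R A' B') \<le> p j * real (card A') * real (card B')" using st unfolding st_def by simp
        show "\<theta> \<le> p j - \<eta>" using j(2) \<theta>(3) \<eta>(2) by linarith
        fix i assume i: "i \<in> S1"
        have "real t * (2 * s) * (2 * real K) * (real (card A') / (2 * real K)) < 1 * (real (card A') / (2 * real K))"
          using s2 A0 K by (intro mult_strict_right_mono) auto
        then have "real t * (2 * s * real (card A')) < real (card A') / (2 * real K)" using K by (simp add: mult_ac)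
        also have "\<dots> \<le> real (card A' div K)" using div_card_bounds(1)[of K "card A'"] KA K by simp
        finally show "X1 i \<subseteq> A' \<and> real (card (X1 i)) \<le> real (card A') / 2 \<and>
          real t * (2 * s * real (card A')) < real (card (X1 i))" using X(1) i half[OF KA(1)] by auto
      next
        fix x assume x: "x \<in> S2"
        have "s * (2 * real K) * (real (card B') / (2 * real K)) \<le> \<theta> ^ t * (real (card B') / (2 * real K))"
          using s1 by (intro mult_right_mono) auto
        then have "s * real (card B') \<le> \<theta> ^ t * (real (card B') / (2 * real K))" using K by simp
        also have "\<dots> \<le> \<theta> ^ t * real (card B' div K)"
          using div_card_bounds(1)[of K "card B'"] KA K \<theta>t by (intro mult_left_mono) auto
        finally show "X2 x \<subseteq> B' \<and> real (card (X2 x)) \<le> real (card B') / 2 \<and>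
          s * real (card B') \<le> \<theta> ^ t * real (card (X2 x))" using X(2) x half[OF KA(2)] by auto
      qed (use fin' ne low s0 s_half \<theta> \<eta> gap S in auto)
      then show False using X(3) by blast
    qed
    have "\<exists>i A' B'. i \<le> j \<and> st i A' B' \<and> (i = j \<or> p i < \<epsilon>)" if "j \<le> J" for j
      using that
    proof (induction j)
      case 0
      have "st 0 A B" unfolding st_def p_def using dens by simp
      then show ?case by blast
    next
      case (Suc j)
      then obtain i A' B' where i: "i \<le> j" "st i A' B'" "i = j \<or> p i < \<epsilon>" by auto
      show ?case
      proof (cases "p i < \<epsilon>")
        case True
        then show ?thesis using i by (meson le_SucI)
      next
        case False
        then show ?thesis using step[of j A' B'] i Suc.prems by (metis Suc_leD not_le order_refl)
      qed
    qed
    then obtain i A' B' where i: "i \<le> J" "st i A' B'" "i = J \<or> p i < \<epsilon>" by blast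
    have "p J < \<epsilon>" unfolding p_def using J \<tau> \<epsilon> by linarith
    then have pe: "p i < \<epsilon>" using i(3) by auto
    have ci: "c \<le> s ^ i" unfolding c_def using i s0 s_half by (intro power_decreasing) auto
    have "c * real (card A) \<le> s ^ i * real (card A)" "c * real (card B) \<le> s ^ i * real (card B)"
      using ci by (intro mult_right_mono; simp)+
    then have "c * real (card A) \<le> real (card A')" "c * real (card B) \<le> real (card B')"
      using i(2) unfolding st_def by linarith+
    moreover have "real (edge_count R A' B') \<le> \<epsilon> * real (card A') * real (card B')"
    proof -
      have "p i * (real (card A') * real (card B')) \<le> \<epsilon> * (real (card A') * real (card B'))"
        using pe by (intro mult_right_mono) auto
      then show ?thesis using i(2) unfolding st_def by (simp add: mult.assoc)
    qed
    moreover have "A' \<subseteq> A" "B' \<subseteq> B" using i(2) unfolding st_def by auto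
    ultimately show "\<exists>A'\<subseteq>A. \<exists>B'\<subseteq>B. c * real (card A) \<le> real (card A') \<and> c * real (card B) \<le> real (card B') \<and>
       real (edge_count R A' B') \<le> \<epsilon> * real (card A') * real (card B')" by blast
  qed
qed

section \<open>A density drop in sparse pairs\<close>

lemma eventually_powr_ge:
  assumes "0 < y"
  shows "\<forall>\<^sub>F n in sequentially. x \<le> real n powr y"
proof -
  have "((\<lambda>n. real n powr (- y)) \<longlongrightarrow> 0) sequentially"
    by (rule tendsto_neg_powr) (use assms filterlim_real_sequentially in auto)
  then have "\<forall>\<^sub>F n in sequentially. real n powr (- y) < 1 / (\<bar>x\<bar> + 1)"
    by (rule order_tendstoD) simp
  moreover have "\<forall>\<^sub>F n in sequentially. 1 \<le> n" by (rule eventually_ge_at_top)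
  ultimately show ?thesis
  proof eventually_elim
    case (elim n)
    then have p: "0 < real n powr y" by simp
    have "1 / (real n powr y) < 1 / (\<bar>x\<bar> + 1)" using elim by (simp add: powr_minus field_simps)
    then have "\<bar>x\<bar> + 1 < real n powr y" using p by (simp add: frac_less_eq divide_less_cancel field_simps)
    then show ?case by simp
  qed
qed

text \<open>
  If at no level \<open>k \<le> t\<close> there is a set of columns of proportion \<open>\<beta> k\<close> seen sparsely by a proportion \<open>s\<close> of the rows,
  the hypothesis \<open>row\<close> of \<open>abundant_copies\<close> holds at all levels.  The exponent
  \<open>\<Lambda> = 2 + C * (t + 1)\<close> is chosen so that the next level absorbs the loss \<open>star_gain\<close>: one factor
  \<open>\<beta> k\<close> is the old level, \<open>C * (t + 1)\<close> factors pay for the power of \<open>\<gamma> k\<close>, and the last one for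
  the constant \<open>g\<close>.
\<close>

lemma density_drop:
  fixes s d \<nu> \<sigma> g :: real and t K C \<Lambda> :: nat
  assumes fin: "finite A" "finite B" and KA: "K \<le> card A" "K \<le> card B" and K: "2 \<le> K" and t: "1 \<le> t"
    and \<Lambda>: "\<Lambda> = 2 + C * (t + 1)" and \<sigma>: "\<sigma> = 1 / (2 * real K * 2 ^ t)" and s: "s = \<sigma> / (4 * real t)"
    and g: "g = (\<sigma> / (16 * real t)) ^ t * \<sigma> / 8"
    and \<nu>: "0 < \<nu>" "\<nu> \<le> 1 / (2 * real K)" "\<nu> \<le> g"
    and d: "0 < d" "d \<le> s"
    and col: "\<And>b. b \<in> B \<Longrightarrow> real (card {a\<in>A. R a b}) \<le> d * real (card A)"
    and S: "star_built F S1 S2" "card S1 \<le> t" "card S2 \<le> t"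
    and free: "(\<forall>i\<in>S1. X1 i \<subseteq> A \<and> card (X1 i) = card A div K)"
       "(\<forall>x\<in>S2. X2 x \<subseteq> B \<and> card (X2 x) = card B div K)"
       "(\<nexists>f1 f2. is_copy R F S1 S2 X1 X2 f1 f2)"
  shows "\<exists>k\<le>t. \<exists>A'\<subseteq>A. \<exists>B'\<subseteq>B. s * real (card A) \<le> real (card A') \<and>
    \<nu> ^ (\<Lambda> ^ k) / 2 * real (card B) \<le> real (card B') \<and>
    (\<forall>b\<in>B'. real (card {a\<in>A'. R a b}) \<le> 2 * (\<nu> ^ (\<Lambda> ^ k)) ^ C * d * real (card A'))"
proof (rule ccontr)
  assume no: "\<not> ?thesis"
  define \<beta> where "\<beta> k = \<nu> ^ (\<Lambda> ^ k)" for k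
  define \<gamma> where "\<gamma> k = \<beta> k ^ C" for k
  define \<sigma>s where "\<sigma>s k = 1 / (2 * real K * 2 ^ k)" for k :: nat
  have ne: "A \<noteq> {}" "B \<noteq> {}" using KA K by auto
  have \<nu>1: "\<nu> \<le> 1"
  proof -
    have "1 / (2 * real K) \<le> 1" using K by simp
    then show ?thesis using \<nu>(2) by linarith
  qed
  have \<beta>: "0 < \<beta> k" "\<beta> k \<le> 1" for k unfolding \<beta>_def using \<nu>(1) \<nu>1 by (auto simp: power_le_one)
  have \<gamma>: "0 < \<gamma> k" "\<gamma> k \<le> 1" for k unfolding \<gamma>_def using \<beta> by (auto simp: power_le_one less_imp_le)
  have \<beta>\<nu>: "\<beta> k \<le> \<nu>" for k
  proof -
    have "1 \<le> \<Lambda> ^ k" using \<Lambda> by simp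
    then have "\<nu> ^ (\<Lambda> ^ k) \<le> \<nu> ^ 1" using \<nu>(1) \<nu>1 by (intro power_decreasing) auto
    then show ?thesis by (simp add: \<beta>_def)
  qed
  have \<sigma>s: "0 < \<sigma>s k" "\<sigma>s k \<le> 1" "\<sigma>s (Suc k) \<le> \<sigma>s k / 2" for k
  proof -
    show "0 < \<sigma>s k" unfolding \<sigma>s_def using K by simp
    show "\<sigma>s (Suc k) \<le> \<sigma>s k / 2" unfolding \<sigma>s_def by simp
    have "1 * 1 \<le> 2 * real K * 2 ^ k" using K by (intro mult_mono) auto
    then show "\<sigma>s k \<le> 1" unfolding \<sigma>s_def by simp
  qed
  have \<sigma>_le: "\<sigma> \<le> \<sigma>s k" if "k \<le> t" for k
    unfolding \<sigma> \<sigma>s_def using that K by (intro divide_left_mono mult_left_mono power_increasing) auto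
  have \<sigma>0: "0 < \<sigma>" using \<sigma> K by simp
  have s0: "0 < s" unfolding s using \<sigma>0 t by simp
  have rows: "real (card {a\<in>A. real (card {b\<in>B'. R a b}) < \<gamma> k * d * real (card B')}) < s * real (card A)"
    if "k \<le> t" "B' \<subseteq> B" "\<beta> k * real (card B) \<le> real (card B')" for k B'
  proof (rule ccontr)
    let ?A = "{a\<in>A. real (card {b\<in>B'. R a b}) < \<gamma> k * d * real (card B')}"
    let ?B = "{b\<in>B'. real (card {a\<in>?A. R a b}) \<le> 2 * (\<gamma> k * d) * real (card ?A)}"
    assume "\<not> ?thesis"
    then have big: "s * real (card A) \<le> real (card ?A)" by simp
    have finB': "finite B'" using that(2) fin(2) finite_subset by blast
    have "0 < s * real (card A)" using s0 ne fin by (simp add: card_gt_0_iff)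
    then have A0: "0 < real (card ?A)" using big by linarith
    then have Ane: "?A \<noteq> {}" by (metis card.empty less_irrefl of_nat_0)
    have "real (edge_count R ?A B') = (\<Sum>a\<in>?A. real (card {b\<in>B'. R a b}))" by (simp add: edge_count_def)
    also have "\<dots> \<le> (\<Sum>a\<in>?A. \<gamma> k * d * real (card B'))" by (rule sum_mono) auto
    also have "\<dots> = \<gamma> k * d * real (card ?A) * real (card B')" by simp
    finally have "real (card B') / 2 \<le> real (card ?B)"
      using fin(1) finB' \<gamma>(1) d(1) Ane by (intro half_columns_light) auto
    then have "\<beta> k / 2 * real (card B) \<le> real (card ?B)" using that(3) by simp
    moreover have "?A \<subseteq> A" "?B \<subseteq> B" using that(2) by auto
    moreover have "\<forall>b\<in>?B. real (card {a\<in>?A. R a b}) \<le> 2 * (\<beta> k) ^ C * d * real (card ?A)"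
      unfolding \<gamma>_def by (simp add: mult.assoc)
    ultimately show False using no that(1) big unfolding \<beta>_def by blast
  qed
  have gain: "\<beta> (Suc k) \<le> star_gain (\<sigma>s k) (\<gamma> k) t * \<beta> k" if "k < t" for k
  proof -
    have sk: "\<sigma> \<le> \<sigma>s k" using \<sigma>_le that by simp
    have "g \<le> (\<sigma>s k / (16 * real t)) ^ t * \<sigma>s k / 8"
      unfolding g using sk \<sigma>0 by (intro divide_right_mono mult_mono power_mono) auto
    then have "\<beta> k \<le> (\<sigma>s k / (16 * real t)) ^ t * \<sigma>s k / 8" using \<beta>\<nu>[of k] \<nu>(3) by linarith
    then have "\<gamma> k ^ (t + 1) * \<beta> k \<le> \<gamma> k ^ (t + 1) * ((\<sigma>s k / (16 * real t)) ^ t * \<sigma>s k / 8)"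
      using \<gamma>(1)[of k] by (intro mult_left_mono) auto
    also have "\<dots> = star_gain (\<sigma>s k) (\<gamma> k) t"
      unfolding star_gain_def by (simp add: power_mult_distrib power_divide mult_ac)
    finally have le: "\<gamma> k ^ (t + 1) * \<beta> k \<le> star_gain (\<sigma>s k) (\<gamma> k) t" .
    have "\<beta> (Suc k) = \<beta> k ^ \<Lambda>" unfolding \<beta>_def by (simp add: power_mult[symmetric] mult.commute)
    also have "\<dots> = \<gamma> k ^ (t + 1) * \<beta> k * \<beta> k"
      unfolding \<gamma>_def \<Lambda> power_mult[symmetric] by (simp add: power_add power2_eq_square mult_ac)
    also have "\<dots> \<le> star_gain (\<sigma>s k) (\<gamma> k) t * \<beta> k"
      using le \<beta>(1)[of k] by (intro mult_right_mono) auto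
    finally show ?thesis .
  qed
  have small: "d \<le> \<sigma>s k / (4 * real t)" "real t * s \<le> \<sigma>s k / 4" if "k \<le> t" for k
  proof -
    have "\<sigma> / (4 * real t) \<le> \<sigma>s k / (4 * real t)" using \<sigma>_le[OF that] by (intro divide_right_mono) auto
    then show "d \<le> \<sigma>s k / (4 * real t)" using d(2) s by linarith
    show "real t * s \<le> \<sigma>s k / 4" using \<sigma>_le[OF that] t unfolding s by simp
  qed
  have "\<exists>f1 f2. is_copy R F S1 S2 X1 X2 f1 f2"
  proof (rule abundant_copies[where k = 0 and J = t and t = t and \<sigma> = \<sigma>s and \<gamma> = \<gamma> and \<beta> = \<beta>
        and d = d and s = s and R = R and A = A and B = B, OF fin ne(2) col d(1) \<sigma>s \<gamma> \<beta>(1) gain small rows S(1,3)])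
    show "0 + card S1 \<le> t" using S(2) by simp
    show "X1 i \<subseteq> A \<and> \<sigma>s 0 * real (card A) \<le> real (card (X1 i))" if "i \<in> S1" for i
      using free(1) that div_card_bounds(1)[of K "card A"] KA K unfolding \<sigma>s_def by simp
    show "X2 x \<subseteq> B \<and> \<beta> 0 * real (card B) \<le> real (card (X2 x))" if "x \<in> S2" for x
    proof -
      have "\<nu> * real (card B) \<le> 1 / (2 * real K) * real (card B)" using \<nu>(2) by (intro mult_right_mono) auto
      also have "\<dots> \<le> real (card B div K)" using div_card_bounds(1)[of K "card B"] KA K by simp
      finally show ?thesis using free(2) that unfolding \<beta>_def by simp
    qed
  qed auto
  then show False using free(3) by blast
qed

section \<open>Iterating the density drop\<close>

text \<open>
  The progress measure is the exponent \<open>m\<close> in \<open>st m\<close>: the step with index \<open>k\<close> counts for \<open>\<Lambda> ^ k\<close>, and in terms of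
  \<open>m\<close> the rows shrink by \<open>s ^ m\<close>, the columns by \<open>(\<nu> / 2) ^ m\<close> and the degrees by
  \<open>(2 * \<nu> ^ C) ^ m\<close>.  Since \<open>\<nu> = n powr (- y)\<close>, no edge is left once \<open>m\<close> reaches about
  \<open>1 / (y * C)\<close>, when the columns have lost a power of \<open>n\<close> of order \<open>1 / C\<close>.  The last step may overshoot
  by \<open>L = \<Lambda> ^ t\<close>, which is harmless because \<open>y * L\<close> is small compared with \<open>c\<close>.
\<close>

lemma sparse_anticomplete:
  fixes c s0 s \<sigma> :: real and t K :: nat
  assumes c: "0 < c" "c < 1" and s0: "0 < s0" "s0 \<le> 1" and K: "2 \<le> K" and t: "1 \<le> t"
    and \<sigma>: "\<sigma> = 1 / (2 * real K * 2 ^ t)" and s: "s = \<sigma> / (4 * real t)"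
  shows "\<exists>\<delta>>0. \<forall>\<^sub>F n in sequentially. \<forall>(R :: 'v \<Rightarrow> 'w \<Rightarrow> bool) (F :: 't \<Rightarrow> 'u \<Rightarrow> bool) S1 S2 A B.
    finite A \<and> finite B \<and> card A \<le> n \<and> s0 * real n \<le> real (card A) \<and> s0 * real n \<le> real (card B) \<and>
    (\<forall>b\<in>B. real (card {a\<in>A. R a b}) \<le> s * real (card A)) \<and>
    star_built F S1 S2 \<and> card S1 \<le> t \<and> card S2 \<le> t \<and>
    copy_free R F S1 S2 K A B \<longrightarrow>
    (\<exists>A'\<subseteq>A. \<exists>B'\<subseteq>B. \<delta> * real n \<le> real (card A') \<and> \<delta> * real n powr (1 - c) \<le> real (card B') \<and>
       (\<forall>a\<in>A'. \<forall>b\<in>B'. \<not> R a b))"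
proof -
  define C where "C = nat \<lceil>8 / c\<rceil> + 1"
  define \<Lambda> where "\<Lambda> = 2 + C * (t + 1)"
  define L where "L = \<Lambda> ^ t"
  \<comment> \<open>Small enough that the columns shrink by a factor of at most \<open>n powr c\<close> for exponents up to \<open>N\<close>.\<close>
  define y where "y = c / (8 * real L)"
  define M where "M = nat \<lceil>1 / (y * real (C - 1))\<rceil>"
  define N where "N = M + L"
  define g where "g = (\<sigma> / (16 * real t)) ^ t * \<sigma> / 8"
  have \<sigma>0: "0 < \<sigma>" using \<sigma> K by simp
  have \<sigma>1: "\<sigma> \<le> 1"
  proof -
    have "1 * 1 \<le> 2 * real K * 2 ^ t" using K by (intro mult_mono) auto
    then show ?thesis unfolding \<sigma> by simp
  qed
  have s_pos: "0 < s" and s_lt: "s < 1"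
  proof -
    show "0 < s" unfolding s using \<sigma>0 t by simp
    have "\<sigma> < 4 * real t" using \<sigma>1 t by linarith
    then show "s < 1" unfolding s using t by simp
  qed
  have g0: "0 < g" unfolding g_def using \<sigma>0 t by simp
  have C8: "8 / c \<le> real (C - 1)" unfolding C_def by (simp add: real_nat_ceiling_ge)
  have "8 < 8 / c" using c by (simp add: field_simps)
  then have C1: "8 < real (C - 1)" using C8 by linarith
  have L1: "1 \<le> L" unfolding L_def \<Lambda>_def by simp
  have y0: "0 < y" unfolding y_def using c L1 by simp
  have yL: "y * real L = c / 8" unfolding y_def using L1 by simp
  have y8: "y \<le> c / 8"
  proof -
    have "y * 1 \<le> y * real L" using L1 y0 by (intro mult_left_mono) auto
    then show ?thesis using yL by simp
  qed
  have M_ge: "1 \<le> y * real (C - 1) * real M"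
  proof -
    have "1 / (y * real (C - 1)) \<le> real M" unfolding M_def by (rule real_nat_ceiling_ge)
    then show ?thesis using y0 C1 by (simp add: field_simps)
  qed
  have yN: "y * real N \<le> 3 * c / 8"
  proof -
    have "0 < 1 / (y * real (C - 1))" using y0 C1 by simp
    moreover have "real (nat \<lceil>x\<rceil>) \<le> x + 1" if "0 < x" for x :: real using that by linarith
    ultimately have "real M \<le> 1 / (y * real (C - 1)) + 1" unfolding M_def by blast
    then have "y * real M \<le> y * (1 / (y * real (C - 1)) + 1)" using y0 by (intro mult_left_mono) auto
    also have "\<dots> = 1 / real (C - 1) + y" using y0 by (simp add: field_simps)
    also have "1 / real (C - 1) \<le> c / 8"
    proof -
      have "1 / real (C - 1) \<le> 1 / (8 / c)" using C8 C1 c by (intro divide_left_mono) auto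
      then show ?thesis by simp
    qed
    finally have "y * real M \<le> c / 4" using y8 by linarith
    then show ?thesis using yL unfolding N_def by (simp add: algebra_simps)
  qed
  define \<delta> where "\<delta> = s ^ N * s0"
  have \<delta>0: "0 < \<delta>" unfolding \<delta>_def using s_pos s0 by simp
  have large: "\<forall>\<^sub>F n in sequentially. 2 * real K \<le> real n powr y \<and> 1 / g \<le> real n powr y \<and>
      real K / \<delta> \<le> real n powr 1 \<and> real K / s0 \<le> real n powr (1 - c) \<and> 1 \<le> n"
    using y0 c by (intro eventually_conj eventually_powr_ge eventually_ge_at_top) auto
  show ?thesis
  proof (intro exI[of _ \<delta>] conjI \<delta>0, rule eventually_mono[OF large], intro allI impI)
    fix n
    assume "2 * real K \<le> real n powr y \<and> 1 / g \<le> real n powr y \<and>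
      real K / \<delta> \<le> real n powr 1 \<and> real K / s0 \<le> real n powr (1 - c) \<and> 1 \<le> n"
    then have n_large: "2 * real K \<le> real n powr y" "1 / g \<le> real n powr y"
      "real K / \<delta> \<le> real n powr 1" "real K / s0 \<le> real n powr (1 - c)" "1 \<le> n" by auto
    fix R :: "'v \<Rightarrow> 'w \<Rightarrow> bool" and F :: "'t \<Rightarrow> 'u \<Rightarrow> bool" and S1 S2 A B
    assume "finite A \<and> finite B \<and> card A \<le> n \<and> s0 * real n \<le> real (card A) \<and> s0 * real n \<le> real (card B) \<and>
      (\<forall>b\<in>B. real (card {a\<in>A. R a b}) \<le> s * real (card A)) \<and>
      star_built F S1 S2 \<and> card S1 \<le> t \<and> card S2 \<le> t \<and>
      copy_free R F S1 S2 K A B"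
    then have fin: "finite A" "finite B" and An: "card A \<le> n" and big: "s0 * real n \<le> real (card A)" "s0 * real n \<le> real (card B)"
      and col: "\<forall>b\<in>B. real (card {a\<in>A. R a b}) \<le> s * real (card A)"
      and S: "star_built F S1 S2" "card S1 \<le> t" "card S2 \<le> t"
      and free: "copy_free R F S1 S2 K A B" by auto
    define \<nu> where "\<nu> = real n powr (- y)"
    have n1: "1 \<le> real n" using n_large(5) by simp
    have \<nu>0: "0 < \<nu>" unfolding \<nu>_def using n1 by simp
    have \<nu>_inv: "\<nu> \<le> 1 / x" if "0 < x" "x \<le> real n powr y" for x
      unfolding \<nu>_def powr_minus_divide using that n1 by (intro divide_left_mono mult_pos_pos) auto
    have \<nu>K: "\<nu> \<le> 1 / (2 * real K)" by (rule \<nu>_inv) (use K n_large(1) in auto)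
    have \<nu>g: "\<nu> \<le> g" using \<nu>_inv[of "1 / g"] g0 n_large(2) by simp
    have \<nu>2: "\<nu> \<le> 1 / 4" using \<nu>_inv[of 4] n_large(1) K by simp
    have \<nu>pow: "\<nu> ^ m = real n powr (- (y * real m))" for m
      unfolding \<nu>_def using n1 by (simp add: powr_powr flip: powr_realpow)
    have \<nu>half: "real n powr (- c) \<le> (\<nu> / 2) ^ N"
    proof -
      have "\<nu> * \<nu> \<le> \<nu> * (1 / 2)" using \<nu>2 \<nu>0 by (intro mult_left_mono) auto
      then have "(\<nu> * \<nu>) ^ N \<le> (\<nu> / 2) ^ N" using \<nu>0 by (intro power_mono) auto
      moreover have "(\<nu> * \<nu>) ^ N = real n powr (- (2 * (y * real N)))"
        unfolding power_mult_distrib \<nu>pow by (simp add: powr_add[symmetric])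
      moreover have "real n powr (- c) \<le> real n powr (- (2 * (y * real N)))"
        using yN n1 c by (intro powr_mono) auto
      ultimately show ?thesis by linarith
    qed
    have \<nu>C: "2 * \<nu> ^ C \<le> \<nu> ^ (C - 1)" "2 * \<nu> ^ C \<le> 1" "0 < 2 * \<nu> ^ C"
    proof -
      have "2 * \<nu> * \<nu> ^ (C - 1) \<le> 1 * \<nu> ^ (C - 1)" using \<nu>2 \<nu>0 by (intro mult_right_mono) auto
      moreover have "\<nu> ^ C = \<nu> * \<nu> ^ (C - 1)" unfolding C_def by simp
      ultimately show 1: "2 * \<nu> ^ C \<le> \<nu> ^ (C - 1)" by simp
      have "\<nu> ^ (C - 1) \<le> 1" using \<nu>0 \<nu>2 by (intro power_le_one) auto
      then show "2 * \<nu> ^ C \<le> 1" using 1 by linarith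
      show "0 < 2 * \<nu> ^ C" using \<nu>0 by simp
    qed
    define st where "st m A' B' \<longleftrightarrow> A' \<subseteq> A \<and> B' \<subseteq> B \<and> s ^ m * real (card A) \<le> real (card A') \<and>
      (\<nu> / 2) ^ m * real (card B) \<le> real (card B') \<and>
      (\<forall>b\<in>B'. real (card {a\<in>A'. R a b}) \<le> s * (2 * \<nu> ^ C) ^ m * real (card A'))" for m A' B'
    have sizes: "\<delta> * real n \<le> real (card A')" "s0 * real n powr (1 - c) \<le> real (card B')"
      if "st m A' B'" "m \<le> N" for m A' B'
    proof -
      have "\<delta> * real n = s ^ N * (s0 * real n)" unfolding \<delta>_def by simp
      also have "\<dots> \<le> s ^ m * real (card A)"
        using big(1) s_pos s_lt that(2) s0 by (intro mult_mono power_decreasing) auto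
      finally show "\<delta> * real n \<le> real (card A')" using that(1) unfolding st_def by linarith
      have "real n powr (1 - c) = real n powr (- c) * real n"
        using n1 powr_add[of "real n" "- c" 1] by simp
      then have "s0 * real n powr (1 - c) = real n powr (- c) * (s0 * real n)" by simp
      also have "\<dots> \<le> (\<nu> / 2) ^ m * real (card B)"
      proof (intro mult_mono)
        have "(\<nu> / 2) ^ N \<le> (\<nu> / 2) ^ m" using \<nu>0 \<nu>2 that(2) by (intro power_decreasing) auto
        then show "real n powr (- c) \<le> (\<nu> / 2) ^ m" using \<nu>half by linarith
      qed (use big(2) s0 \<nu>0 in auto)
      finally show "s0 * real n powr (1 - c) \<le> real (card B')" using that(1) unfolding st_def by linarith
    qed
    have step: "\<exists>k\<le>t. \<exists>A'' B''. st (m + \<Lambda> ^ k) A'' B''" if st: "st m A' B'" "m \<le> N" for m A' B'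
    proof -
      have sub: "A' \<subseteq> A" "B' \<subseteq> B" using st(1) unfolding st_def by auto
      have "real K \<le> \<delta> * real n" "real K \<le> s0 * real n powr (1 - c)"
        using n_large(3,4) \<delta>0 s0 n1 by (simp_all add: field_simps)
      then have KA: "K \<le> card A'" "K \<le> card B'" using sizes[OF st] by linarith+
      obtain X1 X2 where X: "\<forall>i\<in>S1. X1 i \<subseteq> A' \<and> card (X1 i) = card A' div K"
        "\<forall>x\<in>S2. X2 x \<subseteq> B' \<and> card (X2 x) = card B' div K" "\<nexists>f1 f2. is_copy R F S1 S2 X1 X2 f1 f2"
        using copy_freeD[OF free sub] .
      define d where "d = s * (2 * \<nu> ^ C) ^ m"
      have d: "0 < d" "d \<le> s"
      proof -
        show "0 < d" unfolding d_def using s_pos \<nu>C(3) by simp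
        have "(2 * \<nu> ^ C) ^ m \<le> 1" using \<nu>C by (intro power_le_one) auto
        then have "s * (2 * \<nu> ^ C) ^ m \<le> s * 1" using s_pos by (intro mult_left_mono) auto
        then show "d \<le> s" unfolding d_def by simp
      qed
      have "finite A'" "finite B'" using sub fin finite_subset by blast+
      moreover have "\<And>b. b \<in> B' \<Longrightarrow> real (card {a\<in>A'. R a b}) \<le> d * real (card A')"
        using st(1) unfolding st_def d_def by blast
      ultimately obtain k A'' B'' where k: "k \<le> t" and sub': "A'' \<subseteq> A'" "B'' \<subseteq> B'"
        and cA: "s * real (card A') \<le> real (card A'')"
        and cB: "\<nu> ^ (\<Lambda> ^ k) / 2 * real (card B') \<le> real (card B'')"
        and cd: "\<forall>b\<in>B''. real (card {a\<in>A''. R a b}) \<le> 2 * (\<nu> ^ (\<Lambda> ^ k)) ^ C * d * real (card A'')"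
        using density_drop[OF _ _ KA K t \<Lambda>_def \<sigma> s g_def \<nu>0 \<nu>K \<nu>g d _ S X] by blast
      define P where "P = \<Lambda> ^ k"
      have P1: "1 \<le> P" unfolding P_def \<Lambda>_def by simp
      have "st (m + P) A'' B''" unfolding st_def
      proof (intro conjI ballI)
        show "A'' \<subseteq> A" "B'' \<subseteq> B" using sub sub' by auto
        have "s ^ P \<le> s ^ 1" using P1 s_pos s_lt by (intro power_decreasing) auto
        then have "s ^ P * (s ^ m * real (card A)) \<le> s * real (card A')"
          using st(1) s_pos unfolding st_def by (intro mult_mono) auto
        then show "s ^ (m + P) * real (card A) \<le> real (card A'')" using cA by (simp add: power_add mult_ac)
        have two: "(2::real) \<le> 2 ^ P" using P1 power_increasing[of 1 P "2::real"] by simp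
        have "(\<nu> / 2) ^ P \<le> \<nu> ^ P / 2" unfolding power_divide using two \<nu>0 by (intro divide_left_mono) auto
        then have "(\<nu> / 2) ^ P * ((\<nu> / 2) ^ m * real (card B)) \<le> \<nu> ^ P / 2 * real (card B')"
          using st(1) \<nu>0 unfolding st_def by (intro mult_mono) auto
        then show "(\<nu> / 2) ^ (m + P) * real (card B) \<le> real (card B'')"
          using cB unfolding P_def[symmetric] by (simp add: power_add mult_ac)
        fix b assume "b \<in> B''"
        then have "real (card {a\<in>A''. R a b}) \<le> 2 * (\<nu> ^ P) ^ C * d * real (card A'')"
          using cd unfolding P_def by blast
        also have "\<dots> \<le> (2 * \<nu> ^ C) ^ P * d * real (card A'')"
        proof -
          have "2 * (\<nu> ^ P) ^ C \<le> 2 ^ P * (\<nu> ^ P) ^ C" using two \<nu>0 by (intro mult_right_mono) auto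
          also have "\<dots> = (2 * \<nu> ^ C) ^ P" by (simp add: power_mult_distrib power_mult[symmetric] mult.commute)
          finally show ?thesis using d by (intro mult_right_mono) auto
        qed
        finally show "real (card {a\<in>A''. R a b}) \<le> s * (2 * \<nu> ^ C) ^ (m + P) * real (card A'')"
          unfolding d_def by (simp add: power_add mult_ac)
      qed
      then show ?thesis using k unfolding P_def by blast
    qed
    have "\<exists>m A' B'. j \<le> m \<and> m \<le> j + L \<and> st m A' B'" if "j \<le> M" for j
      using that
    proof (induction j)
      case 0
      have "st 0 A B" unfolding st_def using col by simp
      then show ?case by blast
    next
      case (Suc j)
      then obtain m A' B' where m: "j \<le> m" "m \<le> j + L" "st m A' B'" by auto
      show ?case
      proof (cases "m = j")
        case False
        then have "Suc j \<le> m" "m \<le> Suc j + L" using m by auto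
        then show ?thesis using m(3) by blast
      next
        case True
        then have "m \<le> N" using Suc.prems unfolding N_def by simp
        then obtain k A'' B'' where k: "k \<le> t" "st (m + \<Lambda> ^ k) A'' B''" using step[OF m(3)] by blast
        have "1 \<le> \<Lambda> ^ k" "\<Lambda> ^ k \<le> L" unfolding L_def using k(1) \<Lambda>_def by (auto intro: power_increasing)
        then have "Suc j \<le> m + \<Lambda> ^ k" "m + \<Lambda> ^ k \<le> Suc j + L" using True by auto
        then show ?thesis using k(2) by blast
      qed
    qed
    then obtain m A' B' where m: "M \<le> m" "m \<le> M + L" "st m A' B'" by blast
    have mN: "m \<le> N" using m(2) unfolding N_def .
    have none: "\<not> R a b" if ab: "a \<in> A'" "b \<in> B'" for a b
    proof
      assume Rab: "R a b"
      have finA': "finite A'" using m(3) fin(1) unfolding st_def by (meson finite_subset)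
      have cA': "card A' \<le> n" using m(3) An card_mono[OF fin(1), of A'] unfolding st_def by linarith
      have "(2 * \<nu> ^ C) ^ m \<le> (2 * \<nu> ^ C) ^ M" using \<nu>C m(1) by (intro power_decreasing) auto
      also have "\<dots> \<le> (\<nu> ^ (C - 1)) ^ M" using \<nu>C by (intro power_mono) auto
      also have "\<dots> = real n powr (- (y * real ((C - 1) * M)))" 
        using \<nu>pow[of "(C - 1) * M"] by (simp add: power_mult)
      also have "\<dots> \<le> real n powr (- 1)" 
      proof (rule powr_mono)
        show "- (y * real ((C - 1) * M)) \<le> - 1" using M_ge by (simp only: of_nat_mult mult.assoc neg_le_iff_le)
      qed (use n1 in simp)
      also have "\<dots> = 1 / real n" using n1 by (simp add: powr_minus_divide)
      finally have "(2 * \<nu> ^ C) ^ m * real (card A') \<le> 1 / real n * real n"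
        using cA' n1 by (intro mult_mono) auto
      then have "s * ((2 * \<nu> ^ C) ^ m * real (card A')) \<le> s * 1" using s_pos n1 by (intro mult_left_mono) auto
      moreover have "real (card {a\<in>A'. R a b}) \<le> s * (2 * \<nu> ^ C) ^ m * real (card A')"
        using m(3) ab(2) unfolding st_def by blast
      ultimately have "real (card {a\<in>A'. R a b}) < 1" using s_lt by (simp add: mult.assoc)
      then have "card {a\<in>A'. R a b} = 0" by simp
      then show False using ab(1) Rab finA' by auto
    qed
    have "\<delta> * real n powr (1 - c) \<le> s0 * real n powr (1 - c)"
    proof -
      have "s ^ N \<le> 1" using s_pos s_lt by (intro power_le_one) auto
      then have "s ^ N * s0 \<le> 1 * s0" using s0 by (intro mult_right_mono) auto
      then show ?thesis unfolding \<delta>_def by (intro mult_right_mono) auto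
    qed
    then have "\<delta> * real n \<le> real (card A')" "\<delta> * real n powr (1 - c) \<le> real (card B')"
      using sizes[OF m(3) mN] by auto
    then show "\<exists>A'\<subseteq>A. \<exists>B'\<subseteq>B. \<delta> * real n \<le> real (card A') \<and> \<delta> * real n powr (1 - c) \<le> real (card B') \<and>
       (\<forall>a\<in>A'. \<forall>b\<in>B'. \<not> R a b)" using m(3) none unfolding st_def by blast
  qed
qed

section \<open>From all densities to an anticomplete pair\<close>

text \<open>
  Deleting a row of maximum degree does not raise the density.
\<close>

lemma sparse_row_subset:
  fixes p :: real
  assumes "finite A" "n \<le> card A" "real (edge_count R A B) \<le> p * real (card A) * real (card B)"
  shows "\<exists>A'\<subseteq>A. card A' = n \<and> real (edge_count R A' B) \<le> p * real n * real (card B)"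
  using assms
proof (induction "card A - n" arbitrary: A)
  case 0
  then show ?case by (intro exI[of _ A]) auto
next
  case (Suc k)
  then have c1: "n < card A" by simp
  then have ne: "A \<noteq> {}" by auto
  have c0: "0 < real (card A)" using c1 by simp
  define q where "q = real (edge_count R A B) / real (card A)"
  have "q * real (card A) \<le> real (edge_count R A B)" unfolding q_def using c0 by simp
  then obtain a where a: "a \<in> A" "q \<le> real (card {b\<in>B. R a b})"
    using exists_large_row[OF Suc.prems(1) ne] by blast
  have "edge_count R A B = card {b\<in>B. R a b} + edge_count R (A - {a}) B"
    unfolding edge_count_def using Suc.prems(1) a(1) by (simp add: sum.remove)
  then have e: "real (edge_count R (A - {a}) B) = real (edge_count R A B) - real (card {b\<in>B. R a b})" by simp
  have card': "card (A - {a}) = card A - 1" using a(1) Suc.prems(1) by simp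
  then have rc: "real (card (A - {a})) = real (card A) - 1" using c1 by simp
  have "q \<le> p * real (card B)"
    unfolding q_def using Suc.prems(3) c0 by (simp add: field_simps)
  then have "q * (real (card A) - 1) \<le> p * real (card B) * (real (card A) - 1)"
    using c1 by (intro mult_right_mono) auto
  moreover have "real (edge_count R A B) - q = q * (real (card A) - 1)"
    unfolding q_def using c0 by (simp add: field_simps)
  ultimately have "real (edge_count R (A - {a}) B) \<le> p * real (card (A - {a})) * real (card B)"
    using e a(2) unfolding rc by (simp add: mult_ac)
  moreover have "k = card (A - {a}) - n" "n \<le> card (A - {a})" using Suc.hyps(2) c1 card' by auto
  ultimately obtain A' where "A' \<subseteq> A - {a}" "card A' = n" "real (edge_count R A' B) \<le> p * real n * real (card B)"
    using Suc.hyps(1)[of "A - {a}"] Suc.prems(1) by auto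
  then show ?case by blast
qed

lemma edge_count_le_edges:
  assumes "is_ordered_bigraph G"
  shows "edge_count (adj G) (part1 G) (part2 G) \<le> card (edges G)"
proof -
  have fg: "finite (verts G)" "\<forall>e\<in>edges G. e \<subseteq> verts G" and un: "part1 G \<union> part2 G = verts G"
    and disj: "part1 G \<inter> part2 G = {}"
    using assms unfolding is_ordered_bigraph_def finite_graph_def by auto
  have fin: "finite (part1 G)" "finite (part2 G)" using fg(1) un by (metis finite_Un)+
  have finE: "finite (edges G)" using fg by (meson Pow_iff finite_Pow_iff finite_subset subsetI)
  let ?S = "SIGMA a:part1 G. {b\<in>part2 G. adj G a b}"
  have "edge_count (adj G) (part1 G) (part2 G) = card ?S"
    unfolding edge_count_def using fin by (intro card_SigmaI[symmetric]) auto
  also have "\<dots> \<le> card (edges G)"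
  proof (rule card_inj_on_le[OF _ _ finE])
    show "inj_on (\<lambda>(a, b). {a, b}) ?S" using disj by (auto simp: inj_on_def doubleton_eq_iff)
    show "(\<lambda>(a, b). {a, b}) ` ?S \<subseteq> edges G" by auto
  qed
  finally show ?thesis .
qed

theorem mainTheorem5:
  fixes T :: "'a obigraph"
  assumes "is_ordered_tree_bigraph T"
  shows "\<forall>c \<tau> :: real. 0 < c \<and> 0 < \<tau> \<longrightarrow>
    (\<exists>\<delta> > 0. \<forall>(n :: nat) (G :: 'b obigraph).
       1 \<le> n \<and> is_ordered_bigraph G \<and> \<not> contains_obigraph G T \<and>
       n \<le> card (part1 G) \<and> n \<le> card (part2 G) \<and>
       real (card (edges G)) \<le> (1 - \<tau>) * real (card (part1 G)) * real (card (part2 G)) \<longrightarrow>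
       (\<exists>Z1 Z2. Z1 \<subseteq> part1 G \<and> Z2 \<subseteq> part2 G \<and>
          (\<delta> * real n \<le> real (card Z1) \<and> \<delta> * real n powr (1 - c) \<le> real (card Z2) \<or>
           \<delta> * real n powr (1 - c) \<le> real (card Z1) \<and> \<delta> * real n \<le> real (card Z2)) \<and>
          anticomplete G Z1 Z2))"
proof (intro allI impI)
  fix c \<tau> :: real
  assume c\<tau>: "0 < c \<and> 0 < \<tau>"
  have T: "is_ordered_bigraph T" and un: "part1 T \<union> part2 T = verts T" and finT: "finite (verts T)"
    and Tne: "verts T \<noteq> {}"
    using assms unfolding is_ordered_tree_bigraph_def is_ordered_bigraph_def is_tree_def
      finite_graph_def connected_graph_def by auto
  define t where "t = card (verts T)"
  define K where "K = t + 1"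
  have t: "1 \<le> t" unfolding t_def using finT Tne by (simp add: Suc_leI card_gt_0_iff)
  have K: "2 \<le> K" unfolding K_def using t by simp
  have finP: "finite (part1 T)" "finite (part2 T)" using finT un by (metis finite_Un)+
  have cP: "card (part1 T) \<le> t" "card (part2 T) \<le> t"
    unfolding t_def using finT un by (auto intro: card_mono)
  \<comment> \<open>The argument for large \<open>n\<close> needs \<open>n powr (1 - c')\<close> to tend to infinity.\<close>
  define c' where "c' = min c (1 / 2)"
  define \<tau>' where "\<tau>' = min \<tau> 1"
  have c': "0 < c'" "c' < 1" "c' \<le> c" and \<tau>': "0 < \<tau>'" "\<tau>' \<le> 1" "\<tau>' \<le> \<tau>"
    unfolding c'_def \<tau>'_def using c\<tau> by auto
  define \<sigma> where "\<sigma> = 1 / (2 * real K * 2 ^ t)"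
  define s where "s = \<sigma> / (4 * real t)"
  have s: "0 < s" "s / 2 \<le> 1"
  proof -
    show "0 < s" unfolding s_def \<sigma>_def using K t by simp
    have "1 * 1 \<le> 2 * real K * 2 ^ t" using K by (intro mult_mono) auto
    then have "\<sigma> \<le> 1" unfolding \<sigma>_def by simp
    then have "\<sigma> \<le> 2 * (4 * real t)" using t by linarith
    then show "s / 2 \<le> 1" unfolding s_def using t by simp
  qed
  obtain c1 where c1: "0 < c1" and
    sparse: "\<forall>(R :: 'b \<Rightarrow> 'b \<Rightarrow> bool) (F :: 'a \<Rightarrow> 'a \<Rightarrow> bool) S1 S2 A B.
    finite A \<and> finite B \<and> real K \<le> c1 * real (card A) \<and> real K \<le> c1 * real (card B) \<and>
    finite S1 \<and> finite S2 \<and> card S1 \<le> t \<and> card S2 \<le> t \<and>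
    real (edge_count R A B) \<le> (1 - \<tau>') * real (card A) * real (card B) \<and>
    copy_free R F S1 S2 K A B \<longrightarrow>
    (\<exists>A'\<subseteq>A. \<exists>B'\<subseteq>B. c1 * real (card A) \<le> real (card A') \<and> c1 * real (card B) \<le> real (card B') \<and>
       real (edge_count R A' B') \<le> s / 2 * real (card A') * real (card B'))"
    using sparse_subpair[OF \<tau>'(1,2) _ s(2) K, of t] s(1) by auto
  define s0 where "s0 = min 1 (c1 / 2)"
  have s0: "0 < s0" "s0 \<le> 1" "s0 \<le> c1 / 2" unfolding s0_def using c1 by auto
  define good where "good \<delta>1 n \<longleftrightarrow> (\<forall>(R :: 'b \<Rightarrow> 'b \<Rightarrow> bool) (F :: 'a \<Rightarrow> 'a \<Rightarrow> bool) S1 S2 A B.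
    finite A \<and> finite B \<and> card A \<le> n \<and> s0 * real n \<le> real (card A) \<and> s0 * real n \<le> real (card B) \<and>
    (\<forall>b\<in>B. real (card {a\<in>A. R a b}) \<le> s * real (card A)) \<and>
    star_built F S1 S2 \<and> card S1 \<le> t \<and> card S2 \<le> t \<and>
    copy_free R F S1 S2 K A B \<longrightarrow>
    (\<exists>A'\<subseteq>A. \<exists>B'\<subseteq>B. \<delta>1 * real n \<le> real (card A') \<and> \<delta>1 * real n powr (1 - c') \<le> real (card B') \<and>
       (\<forall>a\<in>A'. \<forall>b\<in>B'. \<not> R a b)))" for \<delta>1 n
  have "\<exists>\<delta>1>0. eventually (good \<delta>1) sequentially"
    unfolding good_def using sparse_anticomplete[OF c'(1,2) s0(1,2) K t \<sigma>_def s_def] .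
  then obtain \<delta>1 where \<delta>1: "0 < \<delta>1" and ev: "eventually (good \<delta>1) sequentially" by blast
  have "\<forall>\<^sub>F n in sequentially. real K / c1 \<le> real n powr 1" by (rule eventually_powr_ge) simp
  from eventually_conj[OF ev eventually_conj[OF this eventually_ge_at_top[of K]]]
  obtain n0 where n0: "\<And>n. n0 \<le> n \<Longrightarrow> good \<delta>1 n \<and> real K / c1 \<le> real n powr 1 \<and> K \<le> n"
    unfolding eventually_sequentially by blast
  \<comment> \<open>For \<open>n < n0\<close> the second bound makes a single non-adjacent pair large enough.\<close>
  define \<delta> where "\<delta> = min \<delta>1 (1 / (real n0 + 1))"
  have \<delta>: "0 < \<delta>" "\<delta> \<le> \<delta>1" "\<delta> \<le> 1 / (real n0 + 1)" unfolding \<delta>_def using \<delta>1 by auto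
  have concl: "\<exists>Z1 Z2. Z1 \<subseteq> part1 G \<and> Z2 \<subseteq> part2 G \<and>
      (\<delta> * real n \<le> real (card Z1) \<and> \<delta> * real n powr (1 - c) \<le> real (card Z2)) \<and> anticomplete G Z1 Z2"
    if n: "1 \<le> n" and G: "is_ordered_bigraph G" and free: "\<not> contains_obigraph G T"
      and nG: "n \<le> card (part1 G)" "n \<le> card (part2 G)"
      and ed: "real (card (edges G)) \<le> (1 - \<tau>) * real (card (part1 G)) * real (card (part2 G))"
    for n and G :: "'b obigraph"
  proof -
    have finG: "finite (part1 G)" "finite (part2 G)" and disj: "part1 G \<inter> part2 G = {}"
      using G unfolding is_ordered_bigraph_def finite_graph_def by (metis finite_Un)+
    have rows: "real (edge_count (adj G) (part1 G) (part2 G)) \<le>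
        (1 - \<tau>') * real (card (part1 G)) * real (card (part2 G))"
    proof -
      have "(1 - \<tau>) * (real (card (part1 G)) * real (card (part2 G))) \<le>
          (1 - \<tau>') * (real (card (part1 G)) * real (card (part2 G)))"
        using \<tau>'(3) by (intro mult_right_mono) auto
      then show ?thesis using ed edge_count_le_edges[OF G] by (simp add: mult.assoc)
    qed
    show ?thesis
    proof (cases "n0 \<le> n")
      case False
      have "\<exists>a\<in>part1 G. \<exists>b\<in>part2 G. \<not> adj G a b"
      proof (rule ccontr)
        assume "\<not> ?thesis"
        then have "card {b\<in>part2 G. adj G a b} = card (part2 G)" if "a \<in> part1 G" for a
          using that by (intro arg_cong[of _ _ card]) auto
        then have "real (edge_count (adj G) (part1 G) (part2 G)) = real (card (part1 G)) * real (card (part2 G))"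
          unfolding edge_count_def by simp
        moreover have "0 < real (card (part1 G)) * real (card (part2 G))" using n nG by simp
        then have "(1 - \<tau>') * (real (card (part1 G)) * real (card (part2 G))) < 1 * (real (card (part1 G)) * real (card (part2 G)))"
          using \<tau>'(1) by (intro mult_strict_right_mono) auto
        ultimately show False using rows by (simp add: mult.assoc)
      qed
      then obtain a b where ab: "a \<in> part1 G" "b \<in> part2 G" "\<not> adj G a b" by blast
      have "\<delta> * real n \<le> 1 / (real n0 + 1) * (real n0 + 1)"
        using False \<delta> by (intro mult_mono) auto
      then have d1: "\<delta> * real n \<le> 1" by simp
      have "real n powr (1 - c) \<le> real n powr 1" using n c\<tau> by (intro powr_mono) auto
      then have "\<delta> * real n powr (1 - c) \<le> \<delta> * real n" using \<delta>(1) by (intro mult_left_mono) auto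
      then have "\<delta> * real n powr (1 - c) \<le> 1" using d1 by linarith
      moreover have "anticomplete G {a} {b}" unfolding anticomplete_def using ab disj by auto
      ultimately show ?thesis using d1 ab by (intro exI[of _ "{a}"] exI[of _ "{b}"]) auto
    next
      case True
      have cf: "copy_free (adj G) (adj T) (part1 T) (part2 T) K (part1 G) (part2 G)"
        using obigraph_copy_free[OF G T free, of K] unfolding K_def t_def by simp
  \<comment> \<open>Without column vertices the pattern has no adjacency to respect, so any choice is a copy.\<close>
      have "part2 T \<noteq> {}"
      proof
        assume empty: "part2 T = {}"
        obtain X1 X2 where X: "\<forall>i\<in>part1 T. X1 i \<subseteq> part1 G \<and> card (X1 i) = card (part1 G) div K"
          "\<nexists>f1 f2. is_copy (adj G) (adj T) (part1 T) (part2 T) X1 X2 f1 f2"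
          using copy_freeD[OF cf order_refl order_refl] .
        have "0 < card (part1 G) div K" using n0[OF True] nG K by (simp add: div_greater_zero_iff)
        then have "\<forall>i\<in>part1 T. \<exists>a. a \<in> X1 i" using X(1) by (metis card.empty ex_in_conv less_irrefl)
        then obtain f1 where "\<forall>i\<in>part1 T. f1 i \<in> X1 i" by metis
        then show False using X(2) empty unfolding is_copy_def by blast
      qed
      then obtain w0 where "w0 \<in> part2 T" by blast
      then have built: "star_built (adj T) (part1 T) (part2 T)" using tree_star_built[OF assms] by simp
      obtain A where A: "A \<subseteq> part1 G" "card A = n"
        "real (edge_count (adj G) A (part2 G)) \<le> (1 - \<tau>') * real n * real (card (part2 G))"
        using sparse_row_subset[OF finG(1) nG(1) rows] by blast
      have finA: "finite A" using A(1) finG(1) finite_subset by blast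
      have Kn: "real K \<le> c1 * real n" using n0[OF True] c1 n by (simp add: field_simps)
      have KB: "real K \<le> c1 * real (card (part2 G))"
        using Kn nG(2) c1 by (meson mult_left_mono less_imp_le of_nat_mono order_trans)
      obtain A' B' where A': "A' \<subseteq> A" "c1 * real n \<le> real (card A')"
        and B': "B' \<subseteq> part2 G" "c1 * real (card (part2 G)) \<le> real (card B')"
        and e': "real (edge_count (adj G) A' B') \<le> s / 2 * real (card A') * real (card B')"
      proof -
        have "\<exists>A'\<subseteq>A. \<exists>B'\<subseteq>part2 G. c1 * real (card A) \<le> real (card A') \<and> c1 * real (card (part2 G)) \<le> real (card B') \<and>
          real (edge_count (adj G) A' B') \<le> s / 2 * real (card A') * real (card B')"
        proof (rule sparse[THEN spec[of _ "adj G"], THEN spec[of _ "adj T"], THEN spec[of _ "part1 T"],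
              THEN spec[of _ "part2 T"], THEN spec, THEN spec, THEN mp], intro conjI)
          show "copy_free (adj G) (adj T) (part1 T) (part2 T) K A (part2 G)"
            using copy_free_mono[OF cf A(1) order_refl] .
        qed (use finA finG(2) Kn KB finP cP A(2,3) in simp_all)
        then show ?thesis using that A(2) by auto
      qed
      define B'' where "B'' = {b\<in>B'. real (card {a\<in>A'. adj G a b}) \<le> 2 * (s / 2) * real (card A')}"
      have fin': "finite A'" "finite B'" using A'(1) B'(1) finA finG(2) finite_subset by blast+
      have "0 < real (card A')" using A'(2) Kn K by linarith
      then have "A' \<noteq> {}" by auto
      then have "real (card B') / 2 \<le> real (card B'')"
        unfolding B''_def using fin' e' s(1) by (intro half_columns_light) auto
      moreover have "c1 * real n \<le> c1 * real (card (part2 G))" using nG(2) c1 by (intro mult_left_mono) auto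
      moreover have "s0 * real n \<le> c1 / 2 * real n" using s0(3) by (intro mult_right_mono) auto
      ultimately have cB: "s0 * real n \<le> real (card B'')" using B'(2) by linarith
      have "c1 / 2 * real n \<le> c1 * real n" using c1 by (intro mult_right_mono) auto
      then have cA: "s0 * real n \<le> real (card A')"
        using A'(2) \<open>s0 * real n \<le> c1 / 2 * real n\<close> by linarith
      have "card A' \<le> n" using card_mono[OF finA A'(1)] A(2) by simp
      moreover have "finite B''" unfolding B''_def using fin'(2) by simp
      moreover have "\<forall>b\<in>B''. real (card {a\<in>A'. adj G a b}) \<le> s * real (card A')" unfolding B''_def by simp
      moreover have sub: "A' \<subseteq> part1 G" "B'' \<subseteq> part2 G" using A'(1) A(1) B'(1) unfolding B''_def by auto
      moreover have "copy_free (adj G) (adj T) (part1 T) (part2 T) K A' B''"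
        using copy_free_mono[OF cf sub] .
      ultimately have "\<exists>Z1\<subseteq>A'. \<exists>Z2\<subseteq>B''. \<delta>1 * real n \<le> real (card Z1) \<and>
        \<delta>1 * real n powr (1 - c') \<le> real (card Z2) \<and> (\<forall>a\<in>Z1. \<forall>b\<in>Z2. \<not> adj G a b)"
        using fin'(1) cA cB built cP
          conjunct1[OF n0[OF True], unfolded good_def, THEN spec[of _ "adj G"], THEN spec[of _ "adj T"],
            THEN spec[of _ "part1 T"], THEN spec[of _ "part2 T"], THEN spec[of _ A'], THEN spec[of _ B'']]
        by simp
      then obtain Z1 Z2 where Z: "Z1 \<subseteq> A'" "Z2 \<subseteq> B''" "\<delta>1 * real n \<le> real (card Z1)"
        "\<delta>1 * real n powr (1 - c') \<le> real (card Z2)" "\<forall>a\<in>Z1. \<forall>b\<in>Z2. \<not> adj G a b"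
        by blast
      have "\<delta> * real n \<le> \<delta>1 * real n" using \<delta>(2) by (intro mult_right_mono) auto
      moreover have "\<delta> * real n powr (1 - c) \<le> \<delta>1 * real n powr (1 - c')"
        using \<delta> \<delta>1 n c'(3) by (intro mult_mono powr_mono) auto
      moreover have "anticomplete G Z1 Z2" unfolding anticomplete_def using Z sub disj by blast
      ultimately show ?thesis using Z sub by (intro exI[of _ Z1] exI[of _ Z2]) auto
    qed
  qed
  show "\<exists>\<delta> > 0. \<forall>(n :: nat) (G :: 'b obigraph).
       1 \<le> n \<and> is_ordered_bigraph G \<and> \<not> contains_obigraph G T \<and>
       n \<le> card (part1 G) \<and> n \<le> card (part2 G) \<and>
       real (card (edges G)) \<le> (1 - \<tau>) * real (card (part1 G)) * real (card (part2 G)) \<longrightarrow>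
       (\<exists>Z1 Z2. Z1 \<subseteq> part1 G \<and> Z2 \<subseteq> part2 G \<and>
          (\<delta> * real n \<le> real (card Z1) \<and> \<delta> * real n powr (1 - c) \<le> real (card Z2) \<or>
           \<delta> * real n powr (1 - c) \<le> real (card Z1) \<and> \<delta> * real n \<le> real (card Z2)) \<and>
          anticomplete G Z1 Z2)"
  proof (intro exI[of _ \<delta>] conjI \<delta>(1) allI impI)
    fix n :: nat and G :: "'b obigraph"
    assume H: "1 \<le> n \<and> is_ordered_bigraph G \<and> \<not> contains_obigraph G T \<and>
       n \<le> card (part1 G) \<and> n \<le> card (part2 G) \<and>
       real (card (edges G)) \<le> (1 - \<tau>) * real (card (part1 G)) * real (card (part2 G))"
    have "\<exists>Z1 Z2. Z1 \<subseteq> part1 G \<and> Z2 \<subseteq> part2 G \<and>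
      (\<delta> * real n \<le> real (card Z1) \<and> \<delta> * real n powr (1 - c) \<le> real (card Z2)) \<and> anticomplete G Z1 Z2"
      by (rule concl) (use H in simp_all)
    then obtain Z1 Z2 where "Z1 \<subseteq> part1 G" "Z2 \<subseteq> part2 G"
      "\<delta> * real n \<le> real (card Z1) \<and> \<delta> * real n powr (1 - c) \<le> real (card Z2)" "anticomplete G Z1 Z2"
      by (elim exE conjE) (rule that, simp_all)
    then show "\<exists>Z1 Z2. Z1 \<subseteq> part1 G \<and> Z2 \<subseteq> part2 G \<and>
          (\<delta> * real n \<le> real (card Z1) \<and> \<delta> * real n powr (1 - c) \<le> real (card Z2) \<or>
           \<delta> * real n powr (1 - c) \<le> real (card Z1) \<and> \<delta> * real n \<le> real (card Z2)) \<and>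
          anticomplete G Z1 Z2"
      by (intro exI[of _ Z1] exI[of _ Z2]) simp
  qed
qed

end
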